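(* Let $E$ and $F$ be Archimedean vector lattices. Let $(x_\alpha)_{\alpha\in A}$ be a net in $E$ with $x_\alpha\xrightarrow{o}0$ in $E$ and let $(y_\beta)_{\beta\in B}$ be a net in $F$ with $y_\beta\xrightarrow{o}0$ in $F$. Then the net $(x_\alpha\otimes y_\beta)_{(\alpha,\beta)\in A\times B}$ satisfies $x_\alpha\otimes y_\beta\xrightarrow{o}0$ in the Fremlin tensor product $E\overline{\otimes}F$.
   Context: Order convergence: a net $(x_\alpha)$ in a vector lattice $E$ converges in order to $x\in E$, written $x_\alpha\xrightarrow{o}x$, if there is a net $(u_\gamma)$ in $E$ (possibly over a different index set) with $u_\gamma\downarrow 0$ (decreasing with infimum $0$) such that for every $\gamma$ there is $\alpha_0$ with $|x_\alpha-x|\le u_\gamma$ for all $\alpha\ge\alpha_0$. Fremlin tensor product: for Archimedean vector lattices $E,F$, the space $E\overline{\otimes}F$ is the (essentially unique) Archimedean vector lattice such that (i) the algebraic tensor product $E\otimes F$ is a vector subspace of $E\overline{\otimes}F$; (ii) the vector sublattice generated by $E\otimes F$ is all of $E\overline{\otimes}F$; (iii) the map $(x,y)\mapsto x\otimes y$ is a lattice bimorphism $E\times F\to E\overline{\otimes}F$, and for each Archimedean vector lattice $G$ and each lattice bimorphism $\Phi:E\times F\to G$ there is a unique lattice homomorphism $T:E\overline{\otimes}F\to G$ with $T(x\otimes y)=\Phi(x,y)$ for all $x\in E$, $y\in F$. A lattice bimorphism is a bilinear map $\Phi$ such that $\Phi(x,\cdot)$ and $\Phi(\cdot,y)$ are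 lattice homomorphisms for all $x\in E_+$, $y\in F_+$. The index set $A\times B$ is directed by the product order: $(\alpha,\beta)\le(\alpha',\beta')$ iff $\alpha\le\alpha'$ and $\beta\le\beta'$. *)

theory Defs
  imports "HOL-Analysis.Analysis" "HOL-Analysis.Finite_Function_Topology" "HOL-Library.Lattice_Algebras"
begin

section \<open>Vector lattices\<close>

class vector_lattice = ordered_real_vector + lattice_ab_group_add_abs

class archimedean_vector_lattice = vector_lattice +
  assumes archimedean: "(\<And>n::nat. real n *\<^sub>R x \<le> y) \<Longrightarrow> x \<le> 0"

instance real :: archimedean_vector_lattice
proof
  fix x y :: real
  assume *: "\<And>n::nat. real n *\<^sub>R x \<le> y"
  show "x \<le> 0"
  proof (rule ccontr)
    assume "\<not> x \<le> 0"
    then obtain n where "y < real n * x"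
      using ex_less_of_nat_mult[of x y] by auto
    with *[of n] show False by simp
  qed
qed

text \<open>The universal property below quantifies over all Archimedean vector lattices inside a
  formula, which type classes do not allow.  For this purpose a vector lattice is also described
  by an explicit carrier with explicit operations.\<close>

record 'g vlat =
  vcarrier :: "'g set"
  vzero :: 'g
  vadd :: "'g \<Rightarrow> 'g \<Rightarrow> 'g"
  vscale :: "real \<Rightarrow> 'g \<Rightarrow> 'g"
  vle :: "'g \<Rightarrow> 'g \<Rightarrow> bool"
  vsup :: "'g \<Rightarrow> 'g \<Rightarrow> 'g"
  vinf :: "'g \<Rightarrow> 'g \<Rightarrow> 'g"

locale archimedean_vlat =
  fixes G :: "'g vlat"
  assumes zero_closed: "vzero G \<in> vcarrier G"
    and add_closed: "\<lbrakk>a \<in> vcarrier G; b \<in> vcarrier G\<rbrakk> \<Longrightarrow> vadd G a b \<in> vcarrier G"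
    and scale_closed: "a \<in> vcarrier G \<Longrightarrow> vscale G r a \<in> vcarrier G"
    and sup_closed: "\<lbrakk>a \<in> vcarrier G; b \<in> vcarrier G\<rbrakk> \<Longrightarrow> vsup G a b \<in> vcarrier G"
    and inf_closed: "\<lbrakk>a \<in> vcarrier G; b \<in> vcarrier G\<rbrakk> \<Longrightarrow> vinf G a b \<in> vcarrier G"
    and add_assoc: "\<lbrakk>a \<in> vcarrier G; b \<in> vcarrier G; c \<in> vcarrier G\<rbrakk>
      \<Longrightarrow> vadd G (vadd G a b) c = vadd G a (vadd G b c)"
    and add_commute: "\<lbrakk>a \<in> vcarrier G; b \<in> vcarrier G\<rbrakk> \<Longrightarrow> vadd G a b = vadd G b a"
    and add_zero: "a \<in> vcarrier G \<Longrightarrow> vadd G (vzero G) a = a"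
    and add_inverse: "a \<in> vcarrier G \<Longrightarrow> vadd G (vscale G (- 1) a) a = vzero G"
    and scale_add_right: "\<lbrakk>a \<in> vcarrier G; b \<in> vcarrier G\<rbrakk>
      \<Longrightarrow> vscale G r (vadd G a b) = vadd G (vscale G r a) (vscale G r b)"
    and scale_add_left: "a \<in> vcarrier G
      \<Longrightarrow> vscale G (r + s) a = vadd G (vscale G r a) (vscale G s a)"
    and scale_scale: "a \<in> vcarrier G \<Longrightarrow> vscale G r (vscale G s a) = vscale G (r * s) a"
    and scale_one: "a \<in> vcarrier G \<Longrightarrow> vscale G 1 a = a"
    and le_refl: "a \<in> vcarrier G \<Longrightarrow> vle G a a"
    and le_antisym: "\<lbrakk>a \<in> vcarrier G; b \<in> vcarrier G; vle G a b; vle G b a\<rbrakk> \<Longrightarrow> a = b"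
    and le_trans: "\<lbrakk>a \<in> vcarrier G; b \<in> vcarrier G; c \<in> vcarrier G; vle G a b; vle G b c\<rbrakk>
      \<Longrightarrow> vle G a c"
    and add_mono: "\<lbrakk>a \<in> vcarrier G; b \<in> vcarrier G; c \<in> vcarrier G; vle G a b\<rbrakk>
      \<Longrightarrow> vle G (vadd G c a) (vadd G c b)"
    and scale_mono: "\<lbrakk>a \<in> vcarrier G; b \<in> vcarrier G; vle G a b; 0 \<le> r\<rbrakk>
      \<Longrightarrow> vle G (vscale G r a) (vscale G r b)"
    and sup_upper1: "\<lbrakk>a \<in> vcarrier G; b \<in> vcarrier G\<rbrakk> \<Longrightarrow> vle G a (vsup G a b)"
    and sup_upper2: "\<lbrakk>a \<in> vcarrier G; b \<in> vcarrier G\<rbrakk> \<Longrightarrow> vle G b (vsup G a b)"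
    and sup_least: "\<lbrakk>a \<in> vcarrier G; b \<in> vcarrier G; c \<in> vcarrier G; vle G a c; vle G b c\<rbrakk>
      \<Longrightarrow> vle G (vsup G a b) c"
    and inf_lower1: "\<lbrakk>a \<in> vcarrier G; b \<in> vcarrier G\<rbrakk> \<Longrightarrow> vle G (vinf G a b) a"
    and inf_lower2: "\<lbrakk>a \<in> vcarrier G; b \<in> vcarrier G\<rbrakk> \<Longrightarrow> vle G (vinf G a b) b"
    and inf_greatest: "\<lbrakk>a \<in> vcarrier G; b \<in> vcarrier G; c \<in> vcarrier G; vle G c a; vle G c b\<rbrakk>
      \<Longrightarrow> vle G c (vinf G a b)"
    and archimedean: "\<lbrakk>a \<in> vcarrier G; b \<in> vcarrier G; \<And>n::nat. vle G (vscale G (real n) a) b\<rbrakk>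
      \<Longrightarrow> vle G a (vzero G)"

definition class_vlat :: "'v::vector_lattice vlat" where
  "class_vlat = \<lparr>vcarrier = UNIV, vzero = 0, vadd = (+), vscale = scaleR, vle = (\<le>),
    vsup = sup, vinf = inf\<rparr>"

lemma class_vlat_simps [simp]:
  "vcarrier (class_vlat :: 'v::vector_lattice vlat) = UNIV"
  "vzero (class_vlat :: 'v vlat) = 0"
  "vadd (class_vlat :: 'v vlat) = (+)"
  "vscale (class_vlat :: 'v vlat) = scaleR"
  "vle (class_vlat :: 'v vlat) = (\<le>)"
  "vsup (class_vlat :: 'v vlat) = sup"
  "vinf (class_vlat :: 'v vlat) = inf"
  by (simp_all add: class_vlat_def)

lemma archimedean_vlat_class_vlat:
  "archimedean_vlat (class_vlat :: 'v::archimedean_vector_lattice vlat)"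
  by unfold_locales
    (auto simp: algebra_simps scaleR_left_mono intro: archimedean_vector_lattice_class.archimedean)

definition lattice_hom :: "'g vlat \<Rightarrow> ('v::vector_lattice \<Rightarrow> 'g) \<Rightarrow> bool" where
  "lattice_hom G T \<longleftrightarrow>
    (\<forall>x. T x \<in> vcarrier G) \<and>
    (\<forall>x y. T (x + y) = vadd G (T x) (T y)) \<and>
    (\<forall>r x. T (r *\<^sub>R x) = vscale G r (T x)) \<and>
    (\<forall>x y. T (sup x y) = vsup G (T x) (T y)) \<and>
    (\<forall>x y. T (inf x y) = vinf G (T x) (T y))"

definition lattice_bimorphism ::
    "'g vlat \<Rightarrow> ('e::vector_lattice \<Rightarrow> 'f::vector_lattice \<Rightarrow> 'g) \<Rightarrow> bool" where
  "lattice_bimorphism G \<Phi> \<longleftrightarrow>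
    (\<forall>x y. \<Phi> x y \<in> vcarrier G) \<and>
    (\<forall>x x' y. \<Phi> (x + x') y = vadd G (\<Phi> x y) (\<Phi> x' y)) \<and>
    (\<forall>r x y. \<Phi> (r *\<^sub>R x) y = vscale G r (\<Phi> x y)) \<and>
    (\<forall>x y y'. \<Phi> x (y + y') = vadd G (\<Phi> x y) (\<Phi> x y')) \<and>
    (\<forall>r x y. \<Phi> x (r *\<^sub>R y) = vscale G r (\<Phi> x y)) \<and>
    (\<forall>x. 0 \<le> x \<longrightarrow> lattice_hom G (\<lambda>y. \<Phi> x y)) \<and>
    (\<forall>y. 0 \<le> y \<longrightarrow> lattice_hom G (\<lambda>x. \<Phi> x y))"

definition vector_sublattice :: "'v::vector_lattice set \<Rightarrow> bool" where
  "vector_sublattice S \<longleftrightarrow> subspace S \<and> (\<forall>x\<in>S. \<forall>y\<in>S. sup x y \<in> S \<and> inf x y \<in> S)"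

section \<open>The algebraic tensor product\<close>

definition bilinear_relations ::
    "(('e::real_vector \<times> 'f::real_vector) \<Rightarrow>\<^sub>0 real) set" where
  "bilinear_relations =
    {Poly_Mapping.single (x + x', y) 1 - Poly_Mapping.single (x, y) 1
      - Poly_Mapping.single (x', y) 1 | x x' y. True} \<union>
    {Poly_Mapping.single (x, y + y') 1 - Poly_Mapping.single (x, y) 1
      - Poly_Mapping.single (x, y') 1 | x y y'. True} \<union>
    {Poly_Mapping.single (r *\<^sub>R x, y) 1 - r *\<^sub>R Poly_Mapping.single (x, y) 1 | r x y. True} \<union>
    {Poly_Mapping.single (x, r *\<^sub>R y) 1 - r *\<^sub>R Poly_Mapping.single (x, y) 1 | r x y. True}"

definition tensor_equiv ::
    "(('e::real_vector \<times> 'f::real_vector) \<Rightarrow>\<^sub>0 real) \<Rightarrow> (('e \<times> 'f) \<Rightarrow>\<^sub>0 real) \<Rightarrow> bool" where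
  "tensor_equiv p q \<longleftrightarrow> p - q \<in> span bilinear_relations"

lemma equivp_tensor_equiv:
  "equivp (tensor_equiv :: (('a::real_vector \<times> 'b::real_vector) \<Rightarrow>\<^sub>0 real) \<Rightarrow> _)"
  (is "equivp ?R")
proof (rule equivpI)
  show "reflp ?R"
    by (simp add: reflp_def tensor_equiv_def span_zero)
  show "symp ?R"
    unfolding symp_def tensor_equiv_def
  proof (intro allI impI)
    fix p q :: "('a \<times> 'b) \<Rightarrow>\<^sub>0 real"
    assume "p - q \<in> span bilinear_relations"
    from span_neg[OF this] show "q - p \<in> span bilinear_relations" by simp
  qed
  show "transp ?R"
    unfolding transp_def tensor_equiv_def
  proof (intro allI impI)
    fix p q r :: "('a \<times> 'b) \<Rightarrow>\<^sub>0 real"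
    assume "p - q \<in> span bilinear_relations" "q - r \<in> span bilinear_relations"
    from span_add[OF this] show "p - r \<in> span bilinear_relations" by simp
  qed
qed

quotient_type (overloaded) ('e, 'f) alg_tensor =
  "('e::real_vector \<times> 'f::real_vector) \<Rightarrow>\<^sub>0 real" / tensor_equiv
  by (rule equivp_tensor_equiv)

instantiation alg_tensor :: (real_vector, real_vector) real_vector
begin

lift_definition zero_alg_tensor :: "('a, 'b) alg_tensor" is 0 .

lift_definition plus_alg_tensor ::
    "('a, 'b) alg_tensor \<Rightarrow> ('a, 'b) alg_tensor \<Rightarrow> ('a, 'b) alg_tensor" is "(+)"
  unfolding tensor_equiv_def by (subst add_diff_add) (rule span_add)

lift_definition uminus_alg_tensor :: "('a, 'b) alg_tensor \<Rightarrow> ('a, 'b) alg_tensor" is uminus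
  unfolding tensor_equiv_def by (subst minus_diff_minus) (rule span_neg)

lift_definition minus_alg_tensor ::
    "('a, 'b) alg_tensor \<Rightarrow> ('a, 'b) alg_tensor \<Rightarrow> ('a, 'b) alg_tensor" is "(-)"
  unfolding tensor_equiv_def
proof -
  fix p q p' q' :: "('a \<times> 'b) \<Rightarrow>\<^sub>0 real"
  assume "p - q \<in> span bilinear_relations" "p' - q' \<in> span bilinear_relations"
  then have "(p - q) - (p' - q') \<in> span bilinear_relations" by (rule span_diff)
  then show "p - p' - (q - q') \<in> span bilinear_relations" by (simp add: algebra_simps)
qed

lift_definition scaleR_alg_tensor :: "real \<Rightarrow> ('a, 'b) alg_tensor \<Rightarrow> ('a, 'b) alg_tensor" is scaleR
  unfolding tensor_equiv_def by (subst scaleR_diff_right[symmetric]) (rule span_scale)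

instance
  by standard
    (transfer, simp add: tensor_equiv_def span_zero algebra_simps)+

end

lift_definition pure_tensor :: "'e::real_vector \<Rightarrow> 'f::real_vector \<Rightarrow> ('e, 'f) alg_tensor"
  is "\<lambda>x y. Poly_Mapping.single (x, y) 1" .

definition free_extend ::
    "('e::real_vector \<Rightarrow> 'f::real_vector \<Rightarrow> 'v::real_vector) \<Rightarrow> (('e \<times> 'f) \<Rightarrow>\<^sub>0 real) \<Rightarrow> 'v" where
  "free_extend \<Phi> p =
    (\<Sum>k\<in>Poly_Mapping.keys p. Poly_Mapping.lookup p k *\<^sub>R \<Phi> (fst k) (snd k))"

lemma free_extend_superset:
  assumes "finite K" "Poly_Mapping.keys p \<subseteq> K"
  shows "free_extend \<Phi> p = (\<Sum>k\<in>K. Poly_Mapping.lookup p k *\<^sub>R \<Phi> (fst k) (snd k))"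
  unfolding free_extend_def
  using assms by (intro sum.mono_neutral_left) (auto simp: in_keys_iff)

lemma lookup_scaleR: "Poly_Mapping.lookup (r *\<^sub>R p) k = r * Poly_Mapping.lookup p k"
  for p :: "'k \<Rightarrow>\<^sub>0 real"
proof -
  have "finite {i. r *\<^sub>R Poly_Mapping.lookup p i \<noteq> 0}"
    by (rule finite_subset[OF _ finite_lookup[of p]]) auto
  then show ?thesis by (simp add: scaleR_poly_mapping_def)
qed

lemma linear_free_extend:
  fixes \<Phi> :: "'e::real_vector \<Rightarrow> 'f::real_vector \<Rightarrow> 'v::real_vector"
  shows "linear (free_extend \<Phi>)"
proof
  fix p q :: "('e \<times> 'f) \<Rightarrow>\<^sub>0 real"
  let ?K = "Poly_Mapping.keys p \<union> Poly_Mapping.keys q"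
  have "Poly_Mapping.keys (p + q) \<subseteq> ?K" by (rule Poly_Mapping.keys_add)
  then show "free_extend \<Phi> (p + q) = free_extend \<Phi> p + free_extend \<Phi> q"
    by (simp add: free_extend_superset[of ?K] lookup_add scaleR_add_left sum.distrib)
next
  fix r and p :: "('e \<times> 'f) \<Rightarrow>\<^sub>0 real"
  have "Poly_Mapping.keys (r *\<^sub>R p) \<subseteq> Poly_Mapping.keys p"
    by (auto simp: in_keys_iff lookup_scaleR)
  then show "free_extend \<Phi> (r *\<^sub>R p) = r *\<^sub>R free_extend \<Phi> p"
    by (simp add: free_extend_superset[of "Poly_Mapping.keys p"] lookup_scaleR scaleR_sum_right)
qed

lemma free_extend_single [simp]: "free_extend \<Phi> (Poly_Mapping.single (x, y) 1) = \<Phi> x y"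
  by (simp add: free_extend_def)

lemma free_extend_relations:
  assumes "bilinear \<Phi>" "p \<in> span bilinear_relations"
  shows "free_extend \<Phi> p = 0"
proof -
  interpret F: linear "free_extend \<Phi>" by (rule linear_free_extend)
  have "bilinear_relations \<subseteq> {p. free_extend \<Phi> p = 0}"
    using assms(1)
    by (auto simp: bilinear_relations_def F.diff F.scale bilinear_ladd bilinear_radd
        bilinear_lmul bilinear_rmul)
  then have "span bilinear_relations \<subseteq> {p. free_extend \<Phi> p = 0}"
    by (rule span_minimal) (auto simp: subspace_def F.zero F.add F.scale)
  then show ?thesis using assms(2) by blast
qed

lemma alg_tensor_induct:
  assumes "\<And>x y. P (pure_tensor x y)" "P 0" "\<And>s t. P s \<Longrightarrow> P t \<Longrightarrow> P (s + t)"
    and "\<And>r t. P t \<Longrightarrow> P (r *\<^sub>R t)"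
  shows "P t"
proof -
  have single: "abs_alg_tensor (Poly_Mapping.single k c) = c *\<^sub>R pure_tensor (fst k) (snd k)" for k c
  proof -
    have "Poly_Mapping.single k c = c *\<^sub>R Poly_Mapping.single (fst k, snd k) 1"
      by (rule poly_mapping_eqI) (simp add: lookup_scaleR lookup_single when_def)
    then show ?thesis
      by (simp add: pure_tensor.abs_eq scaleR_alg_tensor.abs_eq)
  qed
  have sums: "P (abs_alg_tensor (\<Sum>k\<in>K. Poly_Mapping.single k (c k)))" if "finite K" for K c
    using that
    by induction (auto simp: single assms simp flip: plus_alg_tensor.abs_eq zero_alg_tensor_def)
  have "P (abs_alg_tensor p)" for p
  proof -
    have "p = (\<Sum>k\<in>Poly_Mapping.keys p. Poly_Mapping.single k (Poly_Mapping.lookup p k))"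
      by (rule poly_mapping_eqI) (simp add: lookup_sum lookup_single when_def in_keys_iff)
    then show ?thesis using sums[of "Poly_Mapping.keys p"] by (metis finite_keys)
  qed
  then show ?thesis by (rule alg_tensor.abs_induct)
qed

lemma bilinear_pure_tensor: "bilinear pure_tensor"
proof -
  note rel = span_base
  have "pure_tensor (x + x') y = pure_tensor x y + pure_tensor x' y" for x x' :: 'a and y :: 'b
    by transfer (unfold tensor_equiv_def bilinear_relations_def diff_diff_eq[symmetric], rule rel, blast)
  moreover have "pure_tensor x (y + y') = pure_tensor x y + pure_tensor x y'" for x :: 'a and y y' :: 'b
    by transfer (unfold tensor_equiv_def bilinear_relations_def diff_diff_eq[symmetric], rule rel, blast)
  moreover have "pure_tensor (r *\<^sub>R x) y = r *\<^sub>R pure_tensor x y" for r and x :: 'a and y :: 'b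
    by transfer (unfold tensor_equiv_def bilinear_relations_def, rule rel, blast)
  moreover have "pure_tensor x (r *\<^sub>R y) = r *\<^sub>R pure_tensor x y" for r and x :: 'a and y :: 'b
    by transfer (unfold tensor_equiv_def bilinear_relations_def, rule rel, blast)
  ultimately show ?thesis
    by (simp add: bilinear_def linear_iff)
qed

theorem alg_tensor_universal:
  fixes \<Phi> :: "'e::real_vector \<Rightarrow> 'f::real_vector \<Rightarrow> 'v::real_vector"
  assumes "bilinear \<Phi>"
  shows "\<exists>!l. linear l \<and> (\<forall>x y. l (pure_tensor x y) = \<Phi> x y)"
proof -
  interpret F: linear "free_extend \<Phi>" by (rule linear_free_extend)
  define l where "l t = free_extend \<Phi> (rep_alg_tensor t)" for t
  have l_abs: "l (abs_alg_tensor p) = free_extend \<Phi> p" for p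
  proof -
    have "tensor_equiv (rep_alg_tensor (abs_alg_tensor p)) p"
      by (rule Quotient3_rep_abs[OF Quotient3_alg_tensor])
        (rule equivp_reflp[OF equivp_tensor_equiv])
    then have "free_extend \<Phi> (rep_alg_tensor (abs_alg_tensor p) - p) = 0"
      unfolding tensor_equiv_def by (rule free_extend_relations[OF assms])
    then show ?thesis by (simp add: l_def F.diff)
  qed
  have "linear l"
  proof
    fix s t :: "('e, 'f) alg_tensor" and r
    obtain p where p: "s = abs_alg_tensor p" by (induct s rule: alg_tensor.abs_induct) blast
    obtain q where q: "t = abs_alg_tensor q" by (induct t rule: alg_tensor.abs_induct) blast
    show "l (s + t) = l s + l t"
      by (simp add: p q plus_alg_tensor.abs_eq l_abs F.add)
    show "l (r *\<^sub>R t) = r *\<^sub>R l t"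
      by (simp add: q scaleR_alg_tensor.abs_eq l_abs F.scale)
  qed
  moreover have l_pure: "l (pure_tensor x y) = \<Phi> x y" for x y
    by (simp add: pure_tensor.abs_eq l_abs)
  moreover have "m = l" if m: "linear m" "\<forall>x y. m (pure_tensor x y) = \<Phi> x y" for m
  proof
    fix t
    interpret m: linear m by fact
    interpret l: linear l by fact
    show "m t = l t"
      by (rule alg_tensor_induct[of "\<lambda>t. m t = l t"])
        (simp_all add: m(2) l_pure m.add l.add m.scale l.scale m.zero l.zero)
  qed
  ultimately show ?thesis by blast
qed

lemma pure_tensor_nonzero:
  fixes x :: "'e::real_vector" and y :: "'f::real_vector"
  assumes "x \<noteq> 0" "y \<noteq> 0"
  shows "pure_tensor x y \<noteq> 0"
proof
  assume 0: "pure_tensor x y = 0"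
  obtain f :: "'e \<Rightarrow> real" where f: "linear f" "f x = 1"
    using linear_independent_extend[of "{x}" "\<lambda>_. 1::real"] assms(1) by auto
  obtain g :: "'f \<Rightarrow> real" where g: "linear g" "g y = 1"
    using linear_independent_extend[of "{y}" "\<lambda>_. 1::real"] assms(2) by auto
  have "bilinear (\<lambda>x y. f x * g y)"
    using f(1) g(1) by (simp add: bilinear_def linear_iff algebra_simps)
  then obtain l where "linear l" "\<forall>x y. l (pure_tensor x y) = f x * g y"
    using alg_tensor_universal by blast
  then have "l 0 = 1" using f(2) g(2) 0 by (metis mult_1)
  with \<open>linear l\<close> show False by (simp add: linear_0)
qed

section \<open>The Fremlin tensor product\<close>

text \<open>The type of the candidate lattice is \<open>'t\<close> and \<open>tn x y\<close> is the tensor of \<open>x\<close> and \<open>y\<close>.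
  The test lattices \<open>G\<close> are those with carrier a subset of \<open>'t\<close>; theorem
  \<open>fremlin_tensor_product_universal\<close> below shows that the universal property then holds
  for Archimedean vector lattices over every type.\<close>

definition fremlin_tensor_product ::
    "('e::archimedean_vector_lattice \<Rightarrow> 'f::archimedean_vector_lattice
      \<Rightarrow> 't::archimedean_vector_lattice) \<Rightarrow> bool" where
  "fremlin_tensor_product tn \<longleftrightarrow>
    (\<exists>\<iota> :: ('e, 'f) alg_tensor \<Rightarrow> 't. linear \<iota> \<and> inj \<iota> \<and> (\<forall>x y. \<iota> (pure_tensor x y) = tn x y)) \<and>
    vector_sublattice hull {tn x y | x y. True} = UNIV \<and>
    lattice_bimorphism class_vlat tn \<and>
    (\<forall>(G :: 't vlat) \<Phi>. archimedean_vlat G \<and> lattice_bimorphism G \<Phi> \<longrightarrow>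
      (\<exists>!T. lattice_hom G T \<and> (\<forall>x y. T (tn x y) = \<Phi> x y)))"

subsection \<open>The universal property for lattices of arbitrary size\<close>

definition transport :: "('g \<Rightarrow> 't) \<Rightarrow> 'g set \<Rightarrow> 'g vlat \<Rightarrow> 't vlat" where
  "transport h S G =
    \<lparr>vcarrier = h ` S,
     vzero = h (vzero G),
     vadd = \<lambda>a b. h (vadd G (inv_into S h a) (inv_into S h b)),
     vscale = \<lambda>r a. h (vscale G r (inv_into S h a)),
     vle = \<lambda>a b. vle G (inv_into S h a) (inv_into S h b),
     vsup = \<lambda>a b. h (vsup G (inv_into S h a) (inv_into S h b)),
     vinf = \<lambda>a b. h (vinf G (inv_into S h a) (inv_into S h b))\<rparr>"

definition closed_in :: "'g vlat \<Rightarrow> 'g set \<Rightarrow> bool" where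
  "closed_in G S \<longleftrightarrow> S \<subseteq> vcarrier G \<and> vzero G \<in> S \<and>
    (\<forall>a\<in>S. \<forall>b\<in>S. vadd G a b \<in> S \<and> vsup G a b \<in> S \<and> vinf G a b \<in> S) \<and>
    (\<forall>r. \<forall>a\<in>S. vscale G r a \<in> S)"

lemma archimedean_vlat_transport:
  assumes "archimedean_vlat G" "closed_in G S" "inj_on h S"
  shows "archimedean_vlat (transport h S G)"
proof -
  interpret G: archimedean_vlat G by fact
  have g: "inv_into S h (h s) = s" if "s \<in> S" for s
    using that assms(3) by (rule inv_into_f_f[rotated])
  have S: "\<And>s. s \<in> S \<Longrightarrow> s \<in> vcarrier G" "vzero G \<in> S"
    "\<And>a b. a \<in> S \<Longrightarrow> b \<in> S \<Longrightarrow> vadd G a b \<in> S"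
    "\<And>a b. a \<in> S \<Longrightarrow> b \<in> S \<Longrightarrow> vsup G a b \<in> S"
    "\<And>a b. a \<in> S \<Longrightarrow> b \<in> S \<Longrightarrow> vinf G a b \<in> S"
    "\<And>r a. a \<in> S \<Longrightarrow> vscale G r a \<in> S"
    using assms(2) by (auto simp: closed_in_def)
  show ?thesis
    apply unfold_locales
                        apply (unfold transport_def vlat.simps)
                        apply (auto simp: g S)[5]
                   apply (elim imageE, simp add: g S G.add_assoc)
                  apply (elim imageE, simp add: g S G.add_commute)
                 apply (elim imageE, simp add: g S G.add_zero)
                apply (elim imageE, simp add: g S G.add_inverse)
               apply (elim imageE, simp add: g S G.scale_add_right)
              apply (elim imageE, simp add: g S G.scale_add_left)
             apply (elim imageE, simp add: g S G.scale_scale)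
            apply (elim imageE, simp add: g S G.scale_one)
           apply (elim imageE, simp add: g S G.le_refl)
          apply (elim imageE, simp add: g S, metis S(1) G.le_antisym)
         apply (elim imageE, simp add: g S, metis S(1) G.le_trans)
        apply (elim imageE, simp add: g S G.add_mono)
       apply (elim imageE, simp add: g S G.scale_mono)
      apply (elim imageE, simp add: g S G.sup_upper1)
     apply (elim imageE, simp add: g S G.sup_upper2)
    apply (elim imageE, simp add: g S G.sup_least)
    apply (elim imageE, simp add: g S G.inf_lower1)
    apply (elim imageE, simp add: g S G.inf_lower2)
    apply (elim imageE, simp add: g S G.inf_greatest)
    apply (elim imageE, simp add: g S, metis S(1) G.archimedean)
    done
qed

primrec gen_level :: "'g vlat \<Rightarrow> 'g set \<Rightarrow> nat \<Rightarrow> 'g set" where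
  "gen_level G X 0 = X"
| "gen_level G X (Suc n) = (let L = gen_level G X n in
    L \<union> (\<lambda>(a, b). vadd G a b) ` (L \<times> L) \<union> (\<lambda>(r, a). vscale G r a) ` (UNIV \<times> L) \<union>
    (\<lambda>(a, b). vsup G a b) ` (L \<times> L) \<union> (\<lambda>(a, b). vinf G a b) ` (L \<times> L))"

definition generated :: "'g vlat \<Rightarrow> 'g set \<Rightarrow> 'g set" where
  "generated G X = (\<Union>n. gen_level G X n)"

lemma gen_level_mono: "m \<le> n \<Longrightarrow> gen_level G X m \<subseteq> gen_level G X n"
  by (rule lift_Suc_mono_le[of "gen_level G X"]) (auto simp: Let_def)

lemma closed_in_generated:
  assumes "archimedean_vlat G" "X \<subseteq> vcarrier G" "X \<noteq> {}"
  shows "closed_in G (generated G X)"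
proof -
  interpret G: archimedean_vlat G by fact
  have "gen_level G X n \<subseteq> vcarrier G" for n
  proof (induction n)
    case (Suc n)
    then show ?case
      by (auto simp: Let_def subset_iff G.add_closed G.scale_closed G.sup_closed G.inf_closed)
  qed (use assms in simp)
  then have sub: "generated G X \<subseteq> vcarrier G"
    by (auto simp: generated_def)
  have bin: "vadd G a b \<in> generated G X \<and> vsup G a b \<in> generated G X \<and> vinf G a b \<in> generated G X"
    if "a \<in> generated G X" "b \<in> generated G X" for a b
  proof -
    obtain m n where "a \<in> gen_level G X m" "b \<in> gen_level G X n"
      using \<open>a \<in> _\<close> \<open>b \<in> _\<close> by (auto simp: generated_def)
    then have ab: "a \<in> gen_level G X (max m n)" "b \<in> gen_level G X (max m n)"
      using gen_level_mono[of m "max m n" G X] gen_level_mono[of n "max m n" G X] by auto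
    have "vadd G a b \<in> gen_level G X (Suc (max m n))"
      "vsup G a b \<in> gen_level G X (Suc (max m n))" "vinf G a b \<in> gen_level G X (Suc (max m n))"
      using ab by (force simp: Let_def simp del: max.bounded_iff)+
    then show ?thesis unfolding generated_def by blast
  qed
  have scale: "vscale G r a \<in> generated G X" if "a \<in> generated G X" for r a
  proof -
    obtain n where "a \<in> gen_level G X n" using \<open>a \<in> _\<close> by (auto simp: generated_def)
    then have "vscale G r a \<in> gen_level G X (Suc n)" by (force simp: Let_def)
    then show ?thesis unfolding generated_def by blast
  qed
  obtain a where "a \<in> X" using assms(3) by blast
  then have a: "a \<in> generated G X" unfolding generated_def by (auto intro: exI[of _ 0])
  have "vzero G \<in> generated G X"
    using bin[OF scale[OF a, of "- 1"] a] G.add_inverse[of a] a sub by auto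
  then show ?thesis using sub bin scale by (auto simp: closed_in_def)
qed

lemma generated_embeds:
  assumes inf: "infinite (UNIV :: 't set)"
    and r: "\<exists>f :: real \<Rightarrow> 't. inj f"
    and X: "\<exists>f :: 'g \<Rightarrow> 't. inj_on f X"
  shows "\<exists>f :: 'g \<Rightarrow> 't. inj_on f (generated G X)"
proof -
  let ?T = "card_of (UNIV :: 't set)"
  have T2: "(card_of ((UNIV :: 't set) \<times> (UNIV :: 't set)), ?T) \<in> ordLeq"
    using card_of_Times_same_infinite[OF inf] by (rule ordIso_imp_ordLeq)
  have pair: "(card_of (f ` (A \<times> B)), ?T) \<in> ordLeq"
    if "(card_of A, ?T) \<in> ordLeq" "(card_of B, ?T) \<in> ordLeq"
    for f :: "'x \<times> 'y \<Rightarrow> 'g" and A B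
  proof -
    have "(card_of (A \<times> B), card_of ((UNIV :: 't set) \<times> (UNIV :: 't set))) \<in> ordLeq"
      by (rule ordLeq_transitive[OF card_of_Times_mono1[OF that(1)] card_of_Times_mono2[OF that(2)]])
    then show ?thesis
      by (intro ordLeq_transitive[OF card_of_image] ordLeq_transitive[OF _ T2])
  qed
  have un: "(card_of (A \<union> B), ?T) \<in> ordLeq"
    if "(card_of A, ?T) \<in> ordLeq" "(card_of B, ?T) \<in> ordLeq" for A B :: "'g set"
    using that inf by (intro card_of_Un_ordLeq_infinite_Field) (simp_all add: card_of_card_order_on Field_card_of)
  have R: "(card_of (UNIV :: real set), ?T) \<in> ordLeq"
    using r card_of_ordLeq[of "UNIV :: real set" "UNIV :: 't set"] by auto
  have level: "(card_of (gen_level G X n), ?T) \<in> ordLeq" for n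
  proof (induction n)
    case 0
    show ?case using X card_of_ordLeq[of X "UNIV :: 't set"] by auto
  next
    case (Suc n)
    show ?case unfolding gen_level.simps Let_def
      by (intro un pair Suc R)
  qed
  have "(card_of (UNIV :: nat set), ?T) \<in> ordLeq"
    using inf infinite_iff_card_of_nat by blast
  then have "(card_of (generated G X), ?T) \<in> ordLeq"
    unfolding generated_def by (intro card_of_UNION_ordLeq_infinite[OF inf]) (auto simp: level)
  then show ?thesis
    using card_of_ordLeq[of "generated G X" "UNIV :: 't set"] by auto
qed

lemma (in archimedean_vlat) scale_zero: "a \<in> vcarrier G \<Longrightarrow> vscale G 0 a = vzero G"
  using scale_add_left[of a "- 1" 1] add_inverse[of a] scale_one[of a] by simp

lemma (in archimedean_vlat) lattice_hom_zero: "lattice_hom G (\<lambda>_. vzero G)"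
proof -
  have "vscale G r (vzero G) = vzero G" for r
    using scale_scale[OF zero_closed, of r 0] scale_zero[OF zero_closed] by simp
  moreover have "vsup G (vzero G) (vzero G) = vzero G" "vinf G (vzero G) (vzero G) = vzero G"
    by (intro le_antisym sup_closed inf_closed zero_closed sup_least sup_upper1
        inf_lower1 inf_greatest le_refl)+
  ultimately show ?thesis
    by (simp add: lattice_hom_def zero_closed add_zero)
qed

lemma lattice_hom_unique:
  assumes gen: "vector_sublattice hull {tn x y | x y. True} = UNIV"
    and T: "lattice_hom G T" "\<forall>x y. T (tn x y) = \<Phi> x y"
    and U: "lattice_hom G U" "\<forall>x y. U (tn x y) = \<Phi> x y"
  shows "T = U"
proof -
  have "T 0 = U 0"
  proof -
    have "T (0 *\<^sub>R tn a b) = U (0 *\<^sub>R tn a b)" for a b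
      using T U unfolding lattice_hom_def by presburger
    then show ?thesis by simp
  qed
  then have "vector_sublattice {t. T t = U t}"
    using T(1) U(1) by (simp add: vector_sublattice_def subspace_def lattice_hom_def)
  then have "vector_sublattice hull {tn x y | x y. True} \<subseteq> {t. T t = U t}"
    using T(2) U(2) by (intro hull_minimal) auto
  with gen show ?thesis by auto
qed

theorem fremlin_tensor_product_universal:
  fixes tn :: "'e::archimedean_vector_lattice \<Rightarrow> 'f::archimedean_vector_lattice
      \<Rightarrow> 't::archimedean_vector_lattice" and G :: "'g vlat"
  assumes tn: "fremlin_tensor_product tn"
    and G: "archimedean_vlat G" and \<Phi>: "lattice_bimorphism G \<Phi>"
  shows "\<exists>!T. lattice_hom G T \<and> (\<forall>x y. T (tn x y) = \<Phi> x y)"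
proof -
  interpret G: archimedean_vlat G by fact
  have gen: "vector_sublattice hull {tn x y | x y. True} = UNIV"
    using tn by (simp add: fremlin_tensor_product_def)
  have \<Phi>_in: "\<Phi> x y \<in> vcarrier G" for x y
    using \<Phi> by (simp add: lattice_bimorphism_def)
  have "\<exists>T. lattice_hom G T \<and> (\<forall>x y. T (tn x y) = \<Phi> x y)"
  proof (cases "(\<forall>x::'e. x = 0) \<or> (\<forall>y::'f. y = 0)")
    case True
    have scale: "\<Phi> (0 *\<^sub>R x) y = vscale G 0 (\<Phi> x y)" "\<Phi> x (0 *\<^sub>R y) = vscale G 0 (\<Phi> x y)" for x y
      using \<Phi> unfolding lattice_bimorphism_def by blast+
    have "\<Phi> x y = vzero G" for x y
    proof -
      have "x = 0 \<or> y = 0" using True by blast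
      then show ?thesis
        using scale[of x y] G.scale_zero[OF \<Phi>_in, of x y] by auto
    qed
    with G.lattice_hom_zero show ?thesis by auto
  next
    case False
    then obtain e :: 'e and f :: 'f where ef: "e \<noteq> 0" "f \<noteq> 0" by blast
    obtain \<iota> :: "('e, 'f) alg_tensor \<Rightarrow> 't"
      where \<iota>: "linear \<iota>" "inj \<iota>" "\<And>x y. \<iota> (pure_tensor x y) = tn x y"
      using tn unfolding fremlin_tensor_product_def by blast
    have nz: "tn x y \<noteq> 0" if "x \<noteq> 0" "y \<noteq> 0" for x y
    proof
      assume "tn x y = 0"
      then have "\<iota> (pure_tensor x y) = \<iota> 0" using \<iota>(1,3) by (simp add: linear_0)
      with pure_tensor_nonzero[OF that] injD[OF \<iota>(2)] show False by blast
    qed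
    have "bilinear (\<lambda>x y. \<iota> (pure_tensor x y))"
      using bilinear_pure_tensor[where 'a='e and 'b='f] \<iota>(1)
      by (simp add: bilinear_def linear_iff)
    then have bil: "bilinear tn" using \<iota>(3) by simp
    have inj_e: "inj (\<lambda>x. tn x f)"
    proof (rule injI)
      fix x x' assume "tn x f = tn x' f"
      then have "tn (x - x') f = 0" by (simp add: bilinear_lsub[OF bil])
      with nz[of "x - x'" f] ef show "x = x'" by auto
    qed
    have inj_f: "inj (\<lambda>y. tn e y)"
    proof (rule injI)
      fix y y' assume "tn e y = tn e y'"
      then have "tn e (y - y') = 0" by (simp add: bilinear_rsub[OF bil])
      with nz[of e "y - y'"] ef show "y = y'" by auto
    qed
    have inj_r: "inj (\<lambda>r. r *\<^sub>R tn e f)"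
      using nz[OF ef] by (auto intro!: injI)
    then have infT: "infinite (UNIV :: 't set)"
      using infinite_UNIV_char_0[where 'a=real] finite_imageD[OF finite_subset[OF subset_UNIV] inj_r]
      by blast
    let ?X = "{\<Phi> x y | x y. True}"
    obtain p :: "'t \<times> 't \<Rightarrow> 't" where p: "inj p"
      using card_of_ordLeq[of "(UNIV :: 't set) \<times> (UNIV :: 't set)" "UNIV :: 't set"]
        ordIso_imp_ordLeq[OF card_of_Times_same_infinite[OF infT]]
      unfolding UNIV_Times_UNIV by blast
    define pre where "pre z = (SOME xy. z = \<Phi> (fst xy) (snd xy))" for z
    have pre: "\<Phi> (fst (pre z)) (snd (pre z)) = z" if "z \<in> ?X" for z
    proof -
      have "\<exists>xy. z = \<Phi> (fst xy) (snd xy)" using that by auto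
      from someI_ex[OF this] show ?thesis unfolding pre_def by simp
    qed
    have "inj_on (\<lambda>z. p (tn (fst (pre z)) f, tn e (snd (pre z)))) ?X"
    proof (rule inj_onI)
      fix z z' assume z: "z \<in> ?X" "z' \<in> ?X"
        and "p (tn (fst (pre z)) f, tn e (snd (pre z))) = p (tn (fst (pre z')) f, tn e (snd (pre z')))"
      then have "tn (fst (pre z)) f = tn (fst (pre z')) f" "tn e (snd (pre z)) = tn e (snd (pre z'))"
        by (simp_all add: inj_eq[OF p])
      then have eq: "fst (pre z) = fst (pre z')" "snd (pre z) = snd (pre z')"
        by (simp_all add: inj_eq[OF inj_e] inj_eq[OF inj_f])
      have "z = \<Phi> (fst (pre z)) (snd (pre z))" by (rule pre[OF z(1), symmetric])
      also have "\<dots> = \<Phi> (fst (pre z')) (snd (pre z'))" by (simp only: eq)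
      also have "\<dots> = z'" by (rule pre[OF z(2)])
      finally show "z = z'" .
    qed
    then obtain h :: "'g \<Rightarrow> 't" where h: "inj_on h (generated G ?X)"
      using generated_embeds[OF infT, of ?X G] inj_r by blast
    define S where "S = generated G ?X"
    note h = h[folded S_def]
    let ?H = "transport h S G"
    have S: "closed_in G S" unfolding S_def using \<Phi>_in by (intro closed_in_generated G) auto
    have \<Phi>S: "\<Phi> x y \<in> S" for x y
    proof -
      have "\<Phi> x y \<in> gen_level G ?X 0" by auto
      then show ?thesis unfolding S_def generated_def by blast
    qed
    have g: "inv_into S h (h s) = s" if "s \<in> S" for s
      using that h by (rule inv_into_f_f[rotated])
    have "lattice_bimorphism ?H (\<lambda>x y. h (\<Phi> x y))"
      using \<Phi> unfolding lattice_bimorphism_def lattice_hom_def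
      by (simp add: transport_def g \<Phi>S)
    then obtain T where T: "lattice_hom ?H T" "\<And>x y. T (tn x y) = h (\<Phi> x y)"
      using tn archimedean_vlat_transport[OF G S h] unfolding fremlin_tensor_product_def by blast
    have Tin: "T t \<in> h ` S" for t
      using T(1) by (simp add: lattice_hom_def transport_def)
    have gT: "inv_into S h (T t) \<in> S" for t
      using Tin by (rule inv_into_into)
    have "lattice_hom G (\<lambda>t. inv_into S h (T t))"
    proof -
      have "vadd G a b \<in> S" "vscale G r a \<in> S" "vsup G a b \<in> S" "vinf G a b \<in> S" "a \<in> vcarrier G"
        if "a \<in> S" "b \<in> S" for a b r
        using S that unfolding closed_in_def by blast+
      note closed = this[OF gT gT]
      have ops: "T (s + t) = vadd ?H (T s) (T t)" "T (r *\<^sub>R t) = vscale ?H r (T t)"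
        "T (sup s t) = vsup ?H (T s) (T t)" "T (inf s t) = vinf ?H (T s) (T t)" for s t r
        using T(1) unfolding lattice_hom_def by blast+
      show ?thesis
        unfolding lattice_hom_def ops by (simp add: transport_def g closed)
    qed
    moreover have "inv_into S h (T (tn x y)) = \<Phi> x y" for x y
      by (simp add: T(2) g \<Phi>S)
    ultimately show ?thesis by blast
  qed
  then show ?thesis
    using lattice_hom_unique[OF gen, of G _ \<Phi>] by blast
qed

section \<open>Order convergence\<close>

definition directed_set :: "'i set \<Rightarrow> ('i \<Rightarrow> 'i \<Rightarrow> bool) \<Rightarrow> bool" where
  "directed_set A le \<longleftrightarrow>
    A \<noteq> {} \<and>
    (\<forall>a\<in>A. le a a) \<and>
    (\<forall>a\<in>A. \<forall>b\<in>A. \<forall>c\<in>A. le a b \<and> le b c \<longrightarrow> le a c) \<and>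
    (\<forall>a\<in>A. \<forall>b\<in>A. \<exists>c\<in>A. le a c \<and> le b c)"

definition prod_le ::
    "('a \<Rightarrow> 'a \<Rightarrow> bool) \<Rightarrow> ('b \<Rightarrow> 'b \<Rightarrow> bool) \<Rightarrow> 'a \<times> 'b \<Rightarrow> 'a \<times> 'b \<Rightarrow> bool" where
  "prod_le leA leB p q \<longleftrightarrow> leA (fst p) (fst q) \<and> leB (snd p) (snd q)"

lemma directed_set_trans:
  assumes "directed_set A le" "a \<in> A" "b \<in> A" "c \<in> A" "le a b" "le b c"
  shows "le a c"
proof -
  have "\<forall>a\<in>A. \<forall>b\<in>A. \<forall>c\<in>A. le a b \<and> le b c \<longrightarrow> le a c"
    using assms(1) unfolding directed_set_def by (elim conjE)
  from this[rule_format, OF assms(2-4) conjI[OF assms(5,6)]] show ?thesis .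
qed

lemma directed_set_refl: "directed_set A le \<Longrightarrow> a \<in> A \<Longrightarrow> le a a"
  unfolding directed_set_def by (elim conjE) (rule bspec)

lemma directed_set_nonempty: "directed_set A le \<Longrightarrow> A \<noteq> {}"
  unfolding directed_set_def by (elim conjE)

lemma directed_set_upper:
  assumes "directed_set A le" "a \<in> A" "b \<in> A"
  obtains c where "c \<in> A" "le a c" "le b c"
proof -
  have "\<forall>a\<in>A. \<forall>b\<in>A. \<exists>c\<in>A. le a c \<and> le b c"
    using assms(1) unfolding directed_set_def by (elim conjE)
  with assms(2,3) that show thesis by blast
qed

lemma directed_set_prod:
  assumes A: "directed_set A leA" and B: "directed_set B leB"
  shows "directed_set (A \<times> B) (prod_le leA leB)"
  unfolding directed_set_def
proof (intro conjI ballI impI)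
  show "A \<times> B \<noteq> {}" using directed_set_nonempty[OF A] directed_set_nonempty[OF B] by simp
  show "prod_le leA leB p p" if "p \<in> A \<times> B" for p
    using directed_set_refl[OF A] directed_set_refl[OF B] that by (auto simp: prod_le_def)
  show "prod_le leA leB p r"
    if "p \<in> A \<times> B" "q \<in> A \<times> B" "r \<in> A \<times> B" "prod_le leA leB p q \<and> prod_le leA leB q r" for p q r
    unfolding prod_le_def
  proof
    show "leA (fst p) (fst r)"
      by (rule directed_set_trans[OF A, of _ "fst q"]) (use that in \<open>auto simp: prod_le_def\<close>)
    show "leB (snd p) (snd r)"
      by (rule directed_set_trans[OF B, of _ "snd q"]) (use that in \<open>auto simp: prod_le_def\<close>)
  qed
  show "\<exists>r\<in>A \<times> B. prod_le leA leB p r \<and> prod_le leA leB q r"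
    if "p \<in> A \<times> B" "q \<in> A \<times> B" for p q
  proof -
    have mem: "fst p \<in> A" "fst q \<in> A" "snd p \<in> B" "snd q \<in> B" using that by auto
    obtain a where "a \<in> A" "leA (fst p) a" "leA (fst q) a"
      using directed_set_upper[OF A mem(1,2)] .
    moreover obtain b where "b \<in> B" "leB (snd p) b" "leB (snd q) b"
      using directed_set_upper[OF B mem(3,4)] .
    ultimately show ?thesis by (intro bexI[of _ "(a, b)"]) (auto simp: prod_le_def)
  qed
qed

definition decreases_to_zero ::
    "'i set \<Rightarrow> ('i \<Rightarrow> 'i \<Rightarrow> bool) \<Rightarrow> ('i \<Rightarrow> 'v::vector_lattice) \<Rightarrow> bool" where
  "decreases_to_zero C le u \<longleftrightarrow>
    directed_set C le \<and>
    (\<forall>c\<in>C. \<forall>d\<in>C. le c d \<longrightarrow> u d \<le> u c) \<and>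
    (\<forall>c\<in>C. 0 \<le> u c) \<and>
    (\<forall>w. (\<forall>c\<in>C. w \<le> u c) \<longrightarrow> w \<le> 0)"

text \<open>The index set of the dominating net is taken in the type of the vector lattice itself;
  by \<open>order_convergesI\<close> an index set of any type serves equally well.\<close>

definition order_converges ::
    "'i set \<Rightarrow> ('i \<Rightarrow> 'i \<Rightarrow> bool) \<Rightarrow> ('i \<Rightarrow> 'v::vector_lattice) \<Rightarrow> 'v \<Rightarrow> bool" where
  "order_converges A le x l \<longleftrightarrow>
    (\<exists>(C :: 'v set) leC u. decreases_to_zero C leC u \<and>
      (\<forall>c\<in>C. \<exists>a0\<in>A. \<forall>a\<in>A. le a0 a \<longrightarrow> \<bar>x a - l\<bar> \<le> u c))"

lemma order_convergesI:
  fixes u :: "'c \<Rightarrow> 'v::vector_lattice"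
  assumes u: "decreases_to_zero C leC u"
    and ev: "\<And>c. c \<in> C \<Longrightarrow> \<exists>a0\<in>A. \<forall>a\<in>A. le a0 a \<longrightarrow> \<bar>x a - l\<bar> \<le> u c"
  shows "order_converges A le x l"
proof -
  have C: "directed_set C leC"
    and anti: "c \<in> C \<Longrightarrow> d \<in> C \<Longrightarrow> leC c d \<Longrightarrow> u d \<le> u c"
    and nonneg: "\<forall>c\<in>C. 0 \<le> u c" and glb: "\<forall>w. (\<forall>c\<in>C. w \<le> u c) \<longrightarrow> w \<le> 0" for c d
    using u unfolding decreases_to_zero_def by (elim conjE, (assumption | simp))+
  have dir: "\<exists>w\<in>u ` C. w \<le> a \<and> w \<le> b" if ab: "a \<in> u ` C" "b \<in> u ` C" for a b
  proof -
    from ab obtain c d where cd: "c \<in> C" "d \<in> C" "a = u c" "b = u d" by auto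
    obtain e where "e \<in> C" "leC c e" "leC d e"
      using directed_set_upper[OF C cd(1,2)] .
    then show ?thesis using anti cd by (intro bexI[of _ "u e"] conjI) simp_all
  qed
  have "directed_set (u ` C) (\<lambda>a b. b \<le> a)"
    unfolding directed_set_def
  proof (intro conjI ballI impI)
    show "u ` C \<noteq> {}" using directed_set_nonempty[OF C] by simp
    show "a \<le> a" for a :: 'v by simp
    show "c \<le> a" if "b \<le> a \<and> c \<le> b" for a b c :: 'v
      using that order_trans by blast
    show "\<exists>w\<in>u ` C. w \<le> a \<and> w \<le> b" if "a \<in> u ` C" "b \<in> u ` C" for a b
      using that by (rule dir)
  qed
  then have "decreases_to_zero (u ` C) (\<lambda>a b. b \<le> a) (\<lambda>v. v)"
    using nonneg glb by (simp add: decreases_to_zero_def)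
  moreover have "\<forall>c\<in>u ` C. \<exists>a0\<in>A. \<forall>a\<in>A. le a0 a \<longrightarrow> \<bar>x a - l\<bar> \<le> c"
    using ev by simp
  ultimately show ?thesis
    unfolding order_converges_def by (intro exI conjI)
qed

end

theory Submission
  imports Defs
begin

text \<open>
  Since \<open>\<bar>x\<^sub>\<alpha> \<otimes> y\<^sub>\<beta>\<bar> \<le> u\<^sub>\<gamma> \<otimes> v\<^sub>\<delta>\<close>, it suffices that \<open>u\<^sub>\<gamma> \<otimes> v\<^sub>\<delta>\<close> decreases to \<open>0\<close>.
  Real-valued lattice homomorphisms separate the points of the ideal generated by \<open>e \<otimes> f\<close>, and
  each such homomorphism normalised at \<open>e \<otimes> f\<close> is a product:
  \<open>\<omega> (a \<otimes> b) = \<omega> (a \<otimes> f) \<omega> (e \<otimes> b)\<close>. Every \<open>w\<close> in the sublattice generated by the tensors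
  is continuous in \<open>\<omega>\<close> with respect to the basic open sets \<open>{\<omega>. 0 < \<omega> (x \<otimes> y)}\<close>, so a lower
  bound \<open>w > 0\<close> of the \<open>u\<^sub>\<gamma> \<otimes> v\<^sub>\<delta>\<close> dominates some \<open>x \<otimes> y\<close> with \<open>x, y > 0\<close>. Evaluating
  homomorphisms again, \<open>x \<otimes> y \<le> u\<^sub>\<gamma> \<otimes> v\<^sub>\<delta>\<close> for a fixed \<open>\<delta>\<close> forces \<open>\<eta> x \<le> u\<^sub>\<gamma>\<close> for a constant
  \<open>\<eta> > 0\<close> and all \<open>\<gamma>\<close>, whence \<open>x \<le> 0\<close>.
\<close>

section \<open>Real-valued lattice homomorphisms on principal ideals\<close>

definition principal_ideal :: "'v::vector_lattice \<Rightarrow> 'v set" where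
  "principal_ideal z = {a. \<exists>n::real. \<bar>a\<bar> \<le> n *\<^sub>R z}"

text \<open>An Archimedean vector lattice may have no nonzero real-valued lattice homomorphism at
  all. Homomorphisms are therefore taken on one principal ideal, normalised at its unit
  \<open>z\<close>; values outside the ideal are unconstrained.\<close>

definition ideal_hom :: "'v::vector_lattice \<Rightarrow> ('v \<Rightarrow> real) \<Rightarrow> bool" where
  "ideal_hom z \<omega> \<longleftrightarrow> \<omega> z = 1 \<and>
    (\<forall>a\<in>principal_ideal z. \<forall>b\<in>principal_ideal z.
      \<omega> (a + b) = \<omega> a + \<omega> b \<and> \<omega> (sup a b) = max (\<omega> a) (\<omega> b)) \<and>
    (\<forall>a\<in>principal_ideal z. \<forall>r. \<omega> (r *\<^sub>R a) = r * \<omega> a)"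

section \<open>Scalars, absolute values and principal ideals\<close>

lemma scaleR_sup:
  fixes a b :: "'v::vector_lattice"
  assumes "0 \<le> r"
  shows "r *\<^sub>R sup a b = sup (r *\<^sub>R a) (r *\<^sub>R b)"
proof (cases "r = 0")
  case False
  show ?thesis
  proof (rule antisym)
    have "sup a b \<le> (1 / r) *\<^sub>R sup (r *\<^sub>R a) (r *\<^sub>R b)"
    proof (rule sup_least)
      have "(1 / r) *\<^sub>R (r *\<^sub>R c) \<le> (1 / r) *\<^sub>R sup (r *\<^sub>R a) (r *\<^sub>R b)"
        if "r *\<^sub>R c \<le> sup (r *\<^sub>R a) (r *\<^sub>R b)" for c
        using that assms by (intro scaleR_left_mono) auto
      then show "a \<le> (1 / r) *\<^sub>R sup (r *\<^sub>R a) (r *\<^sub>R b)" "b \<le> (1 / r) *\<^sub>R sup (r *\<^sub>R a) (r *\<^sub>R b)"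
        using False by force+
    qed
    from scaleR_left_mono[OF this assms] False
    show "r *\<^sub>R sup a b \<le> sup (r *\<^sub>R a) (r *\<^sub>R b)" by simp
    show "sup (r *\<^sub>R a) (r *\<^sub>R b) \<le> r *\<^sub>R sup a b"
      using assms by (intro sup_least scaleR_left_mono) auto
  qed
qed simp

lemma abs_scaleR: "\<bar>r *\<^sub>R a\<bar> = \<bar>r\<bar> *\<^sub>R \<bar>a\<bar>" for a :: "'v::vector_lattice"
proof (cases "0 \<le> r")
  case True
  then show ?thesis by (simp add: abs_lattice[where 'a='v] scaleR_sup)
next
  case False
  then have "\<bar>r\<bar> *\<^sub>R \<bar>a\<bar> = sup (\<bar>r\<bar> *\<^sub>R a) (\<bar>r\<bar> *\<^sub>R (- a))"
    unfolding abs_lattice[where 'a='v] by (intro scaleR_sup) simp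
  with False show ?thesis by (simp add: abs_lattice[where 'a='v] sup_commute)
qed

lemma principal_idealI: "0 \<le> a \<Longrightarrow> a \<le> n *\<^sub>R z \<Longrightarrow> a \<in> principal_ideal z"
  unfolding principal_ideal_def by auto

lemma principal_ideal_bound:
  assumes "a \<in> principal_ideal z" "0 \<le> z"
  obtains n where "0 \<le> n" "\<bar>a\<bar> \<le> n *\<^sub>R z"
proof -
  obtain n where "\<bar>a\<bar> \<le> n *\<^sub>R z" using assms(1) by (auto simp: principal_ideal_def)
  also have "\<dots> \<le> \<bar>n\<bar> *\<^sub>R z" using assms(2) by (intro scaleR_right_mono) auto
  finally show thesis using that[of "\<bar>n\<bar>"] by simp
qed

lemma principal_ideal_self: "0 \<le> z \<Longrightarrow> z \<in> principal_ideal z"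
  by (rule principal_idealI[of _ 1]) auto

lemma principal_ideal_scale: "a \<in> principal_ideal z \<Longrightarrow> r *\<^sub>R a \<in> principal_ideal z"
proof -
  assume "a \<in> principal_ideal z"
  then obtain n where "\<bar>a\<bar> \<le> n *\<^sub>R z" by (auto simp: principal_ideal_def)
  then have "\<bar>r *\<^sub>R a\<bar> \<le> (\<bar>r\<bar> * n) *\<^sub>R z"
    unfolding abs_scaleR by (metis abs_ge_zero scaleR_left_mono scaleR_scaleR)
  then show ?thesis by (auto simp: principal_ideal_def)
qed

lemma principal_ideal_add:
  assumes "a \<in> principal_ideal z" "b \<in> principal_ideal z"
  shows "a + b \<in> principal_ideal z"
proof -
  obtain n m where "\<bar>a\<bar> \<le> n *\<^sub>R z" "\<bar>b\<bar> \<le> m *\<^sub>R z" using assms by (auto simp: principal_ideal_def)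
  then have "\<bar>a + b\<bar> \<le> (n + m) *\<^sub>R z"
    unfolding scaleR_add_left by (meson abs_triangle_ineq add_mono order_trans)
  then show ?thesis by (auto simp: principal_ideal_def)
qed

lemma principal_ideal_uminus: "a \<in> principal_ideal z \<Longrightarrow> - a \<in> principal_ideal z"
  by (simp add: principal_ideal_def)

lemma principal_ideal_diff:
  "a \<in> principal_ideal z \<Longrightarrow> b \<in> principal_ideal z \<Longrightarrow> a - b \<in> principal_ideal z"
  using principal_ideal_add[of a z "- b"] principal_ideal_uminus[of b z] by simp

text \<open>The sum of the absolute values bounds \<open>a\<close>, \<open>b\<close> and
  \<open>- a\<close>, and the negative of the supremum lies below \<open>- a\<close>.\<close>

lemma abs_sup_le: "\<bar>sup a b\<bar> \<le> \<bar>a\<bar> + \<bar>b\<bar>" for a b :: "'v::vector_lattice"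
proof -
  have le: "a \<le> \<bar>a\<bar> + \<bar>b\<bar>" "- a \<le> \<bar>a\<bar> + \<bar>b\<bar>" "b \<le> \<bar>a\<bar> + \<bar>b\<bar>"
    using abs_ge_self[of a] abs_ge_self[of b] abs_ge_minus_self[of a]
      abs_ge_zero[of a] abs_ge_zero[of b]
    by (metis add.right_neutral add.left_neutral add_mono)+
  have "- sup a b \<le> - a" unfolding neg_le_iff_le by (rule sup_ge1)
  from order_trans[OF this le(2)] show ?thesis by (rule abs_leI[OF sup_least[OF le(1,3)]])
qed

lemma principal_ideal_sup:
  assumes "a \<in> principal_ideal z" "b \<in> principal_ideal z"
  shows "sup a b \<in> principal_ideal z"
proof -
  have "\<bar>a\<bar> + \<bar>b\<bar> \<in> principal_ideal z"
    using assms by (intro principal_ideal_add) (auto simp: principal_ideal_def)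
  then obtain n where "\<bar>a\<bar> + \<bar>b\<bar> \<le> n *\<^sub>R z"
    by (auto simp: principal_ideal_def intro: order_trans[OF abs_ge_self])
  with abs_sup_le[of a b] show ?thesis by (auto simp: principal_ideal_def intro: order_trans)
qed

lemma principal_ideal_abs: "a \<in> principal_ideal z \<Longrightarrow> \<bar>a\<bar> \<in> principal_ideal z"
  by (simp add: principal_ideal_def)

lemma principal_ideal_zero: "0 \<le> z \<Longrightarrow> 0 \<in> principal_ideal z"
  by (rule principal_idealI[of _ 1]) auto

section \<open>Maximal cones and the homomorphisms they define\<close>

text \<open>The cones below model the elements that become nonpositive modulo a lattice ideal
  not containing \<open>z\<close>; for a maximal cone the quotient is totally ordered.\<close>

definition ideal_cone :: "'v::vector_lattice \<Rightarrow> 'v set \<Rightarrow> bool" where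
  "ideal_cone z Q \<longleftrightarrow> 0 \<in> Q \<and> z \<notin> Q \<and> (\<forall>a\<in>Q. \<forall>b. b \<le> a \<longrightarrow> b \<in> Q) \<and>
    (\<forall>a\<in>Q. \<forall>b\<in>Q. a + b \<in> Q \<and> sup a b \<in> Q) \<and> (\<forall>a\<in>Q. \<forall>r\<ge>0. r *\<^sub>R a \<in> Q)"

lemma ideal_coneD:
  assumes "ideal_cone z Q"
  shows "0 \<in> Q" "z \<notin> Q" "\<And>a b. a \<in> Q \<Longrightarrow> b \<le> a \<Longrightarrow> b \<in> Q"
    "\<And>a b. a \<in> Q \<Longrightarrow> b \<in> Q \<Longrightarrow> a + b \<in> Q" "\<And>a b. a \<in> Q \<Longrightarrow> b \<in> Q \<Longrightarrow> sup a b \<in> Q"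
    "\<And>a r. a \<in> Q \<Longrightarrow> 0 \<le> r \<Longrightarrow> r *\<^sub>R a \<in> Q"
  using assms unfolding ideal_cone_def by blast+

text \<open>This is the cone generated by \<open>Q\<close> and \<open>c\<close>. Since
  \<open>0 \<le> c\<close>, the larger of two coefficients of \<open>c\<close> serves both elements,
  which gives closure under suprema; the last hypothesis keeps \<open>z\<close> outside.\<close>

lemma ideal_cone_extend:
  assumes Q: "ideal_cone z Q" and c: "0 \<le> c"
    and z: "\<And>q r. q \<in> Q \<Longrightarrow> 0 \<le> r \<Longrightarrow> \<not> z \<le> q + r *\<^sub>R c"
  shows "ideal_cone z {a. \<exists>q\<in>Q. \<exists>r\<ge>0. a \<le> q + r *\<^sub>R c}" (is "ideal_cone z ?R")
  unfolding ideal_cone_def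
proof (intro conjI ballI allI impI)
  note D = ideal_coneD[OF Q]
  show "0 \<in> ?R" using D(1) by force
  show "z \<notin> ?R" using z by blast
  show "b \<in> ?R" if "a \<in> ?R" "b \<le> a" for a b using that order_trans by blast
  show "r *\<^sub>R a \<in> ?R" if "a \<in> ?R" and r: "0 \<le> r" for a r
  proof -
    obtain q s where qs: "q \<in> Q" "0 \<le> s" "a \<le> q + s *\<^sub>R c" using \<open>a \<in> ?R\<close> by blast
    have "r *\<^sub>R a \<le> r *\<^sub>R q + (r * s) *\<^sub>R c"
      using scaleR_left_mono[OF qs(3) r] by (simp add: scaleR_add_right)
    then show ?thesis using D(6)[OF qs(1) r] qs(2) r by (auto intro!: bexI exI[of _ "r * s"])
  qed
  fix a b assume "a \<in> ?R" "b \<in> ?R"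
  then obtain q s q' s' where qs: "q \<in> Q" "0 \<le> s" "a \<le> q + s *\<^sub>R c"
    "q' \<in> Q" "0 \<le> s'" "b \<le> q' + s' *\<^sub>R c" by blast
  have "a + b \<le> (q + q') + (s + s') *\<^sub>R c"
    using add_mono[OF qs(3,6)] by (simp add: algebra_simps)
  then show "a + b \<in> ?R" using D(4)[OF qs(1,4)] qs(2,5) by (auto intro!: bexI exI[of _ "s + s'"])
  have "a \<le> sup q q' + max s s' *\<^sub>R c" "b \<le> sup q q' + max s s' *\<^sub>R c"
    using qs c by (auto elim!: order_trans intro!: add_mono scaleR_right_mono)
  then have "sup a b \<le> sup q q' + max s s' *\<^sub>R c" by simp
  then show "sup a b \<in> ?R"
    using D(5)[OF qs(1,4)] qs(2,5) by (auto intro!: bexI exI[of _ "max s s'"])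
qed

text \<open>Zorn's lemma: each closure condition involves at most two elements, and these lie in a
  common member of a chain.\<close>

lemma ideal_cone_maximal_exists:
  assumes "ideal_cone z Q0"
  obtains Q where "ideal_cone z Q" "Q0 \<subseteq> Q" "\<And>R. ideal_cone z R \<Longrightarrow> Q \<subseteq> R \<Longrightarrow> R = Q"
proof -
  let ?A = "{Q. ideal_cone z Q \<and> Q0 \<subseteq> Q}"
  have "\<exists>M\<in>?A. \<forall>X\<in>?A. M \<subseteq> X \<longrightarrow> X = M"
  proof (rule subset_Zorn_nonempty)
    show "?A \<noteq> {}" using assms by auto
    fix \<C> assume ne: "\<C> \<noteq> {}" and ch: "subset.chain ?A \<C>"
    have mem: "Q \<in> \<C> \<Longrightarrow> ideal_cone z Q \<and> Q0 \<subseteq> Q" for Q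
      using ch unfolding subset.chain_def by blast
    have "ideal_cone z (\<Union>\<C>)"
      unfolding ideal_cone_def
    proof (intro conjI ballI allI impI)
      show "0 \<in> \<Union>\<C>" using ne mem ideal_coneD(1) by blast
      show "z \<notin> \<Union>\<C>" using mem ideal_coneD(2) by blast
      show "b \<in> \<Union>\<C>" if "a \<in> \<Union>\<C>" "b \<le> a" for a b
        using that mem ideal_coneD(3) by blast
      show "r *\<^sub>R a \<in> \<Union>\<C>" if "a \<in> \<Union>\<C>" "0 \<le> r" for a r
        using that mem ideal_coneD(6) by blast
      fix a b assume "a \<in> \<Union>\<C>" "b \<in> \<Union>\<C>"
      then obtain P R where "P \<in> \<C>" "R \<in> \<C>" "a \<in> P" "b \<in> R" by blast
      moreover from this ch have "P \<subseteq> R \<or> R \<subseteq> P" unfolding subset.chain_def by blast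
      ultimately obtain S where "S \<in> \<C>" "a \<in> S" "b \<in> S" by blast
      then show "a + b \<in> \<Union>\<C>" "sup a b \<in> \<Union>\<C>"
        using mem ideal_coneD(4,5) by blast+
    qed
    then show "\<Union>\<C> \<in> ?A" using ne mem by blast
  qed
  then obtain M where "ideal_cone z M" "Q0 \<subseteq> M" "\<forall>X. ideal_cone z X \<and> Q0 \<subseteq> X \<longrightarrow> M \<subseteq> X \<longrightarrow> X = M"
    by auto
  then show thesis by (intro that[of M]) auto
qed

text \<open>The positive part is \<open>a\<close> plus the negative part, so the negative part can
  be pulled out of the infimum; what remains, \<open>inf a 0\<close>, is minus the negative
  part.\<close>

lemma inf_pos_neg: "inf (sup a 0) (sup (- a) 0) = 0" for a :: "'v::vector_lattice"
proof -
  have "sup a 0 = a + sup (- a) 0" by (simp add: add_sup_distrib_left sup_commute)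
  then have "inf (sup a 0) (sup (- a) 0) = inf a 0 + sup (- a) 0"
    by (metis add.left_neutral add_inf_distrib_right)
  also have "\<dots> = 0" by (metis add.right_inverse neg_inf_eq_sup minus_zero)
  finally show ?thesis .
qed

text \<open>If \<open>a\<close> and \<open>- a\<close> both lie outside \<open>Q\<close>, so do the
  positive and the negative part of \<open>a\<close>. By maximality, adjoining either part captures
  \<open>z\<close>, and both bounds can be given the same element of \<open>Q\<close> and the same
  coefficient. As the parts are disjoint, \<open>z\<close> lies below that element of
  \<open>Q\<close>, a contradiction.\<close>

lemma ideal_cone_maximal_total:
  assumes Q: "ideal_cone z Q" and max: "\<And>R. ideal_cone z R \<Longrightarrow> Q \<subseteq> R \<Longrightarrow> R = Q"
  shows "a \<in> Q \<or> - a \<in> Q"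
proof (rule ccontr)
  note D = ideal_coneD[OF Q]
  assume "\<not> ?thesis"
  then have na: "sup a 0 \<notin> Q" "sup (- a) 0 \<notin> Q" using D(3) by (meson sup_ge1)+
  have ext: "\<exists>q\<in>Q. \<exists>r\<ge>0. z \<le> q + r *\<^sub>R c" if c: "0 \<le> c" "c \<notin> Q" for c
  proof (rule ccontr)
    assume n: "\<not> ?thesis"
    let ?R = "{a. \<exists>q\<in>Q. \<exists>r\<ge>0. a \<le> q + r *\<^sub>R c}"
    have "ideal_cone z ?R" using n by (intro ideal_cone_extend[OF Q c(1)]) blast
    moreover have "Q \<subseteq> ?R" by force
    ultimately have "?R = Q" by (rule max)
    moreover have "c \<in> ?R" using D(1) by (auto intro!: bexI[of _ 0] exI[of _ 1])
    ultimately show False using c(2) by simp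
  qed
  obtain q r where q: "q \<in> Q" "0 \<le> r" "z \<le> q + r *\<^sub>R sup a 0" using ext[OF _ na(1)] by auto
  obtain q' r' where q': "q' \<in> Q" "0 \<le> r'" "z \<le> q' + r' *\<^sub>R sup (- a) 0"
    using ext[OF _ na(2)] by auto
  let ?q = "sup q q'" and ?r = "max r r'"
  have "z \<le> ?q + ?r *\<^sub>R sup a 0"
    using q(3) by (rule order_trans) (intro add_mono scaleR_right_mono; simp)
  moreover have "z \<le> ?q + ?r *\<^sub>R sup (- a) 0"
    using q'(3) by (rule order_trans) (intro add_mono scaleR_right_mono; simp)
  ultimately have "z - ?q \<le> inf (?r *\<^sub>R sup a 0) (?r *\<^sub>R sup (- a) 0)"
    by (intro le_infI) (simp_all only: diff_le_eq add.commute)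
  \<comment> \<open>A positive coefficient can be divided out, which reduces the infimum to
    \<open>inf_pos_neg\<close>.\<close>
  also have "\<dots> \<le> 0"
  proof (cases "?r = 0")
    case False
    with q(2) have r: "0 < ?r" by (simp add: less_le)
    let ?i = "inf (?r *\<^sub>R sup a 0) (?r *\<^sub>R sup (- a) 0)"
    have "(1 / ?r) *\<^sub>R ?i \<le> (1 / ?r) *\<^sub>R (?r *\<^sub>R sup a 0)" "(1 / ?r) *\<^sub>R ?i \<le> (1 / ?r) *\<^sub>R (?r *\<^sub>R sup (- a) 0)"
      using r by (intro scaleR_left_mono; simp)+
    then have "(1 / ?r) *\<^sub>R ?i \<le> inf (sup a 0) (sup (- a) 0)" using r by simp
    then have "?r *\<^sub>R ((1 / ?r) *\<^sub>R ?i) \<le> ?r *\<^sub>R 0"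
      unfolding inf_pos_neg using r by (intro scaleR_left_mono) auto
    then show ?thesis using r by simp
  qed simp
  finally have "z \<le> ?q" by (simp only: diff_le_0_iff_le)
  with D(2,3) D(5)[OF q(1) q'(1)] show False by blast
qed

text \<open>Read \<open>a \<in> Q\<close> as: \<open>a\<close> is nonpositive modulo
  \<open>Q\<close>. By totality each \<open>a\<close> in the ideal cuts the real line into the
  \<open>r\<close> with \<open>r *\<^sub>R z\<close> below \<open>a\<close> and those with it above;
  the cut point is the value at \<open>a\<close>.\<close>

lemma ideal_cone_maximal_hom:
  assumes Q: "ideal_cone z Q" and total: "\<And>a. a \<in> Q \<or> - a \<in> Q" and z: "0 \<le> z"
  obtains \<omega> where "ideal_hom z \<omega>"
    "\<And>a r. a \<in> principal_ideal z \<Longrightarrow> r *\<^sub>R z - a \<in> Q \<Longrightarrow> r \<le> \<omega> a"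
proof -
  note D = ideal_coneD[OF Q]
  define \<omega> where "\<omega> a = Sup {r. r *\<^sub>R z - a \<in> Q}" for a
  \<comment> \<open>Consistency of the cut: for \<open>s < r\<close>, adding the two elements would
    put a positive multiple of \<open>z\<close> into \<open>Q\<close>.\<close>
  have le: "r \<le> s" if "r *\<^sub>R z - a \<in> Q" "a - s *\<^sub>R z \<in> Q" for r s a
  proof (rule ccontr)
    assume "\<not> r \<le> s"
    then have "(1 / (r - s)) *\<^sub>R ((r *\<^sub>R z - a) + (a - s *\<^sub>R z)) \<in> Q"
      using that by (intro D(4,6)) auto
    also have "(r *\<^sub>R z - a) + (a - s *\<^sub>R z) = (r - s) *\<^sub>R z" by (simp add: algebra_simps)
    finally show False using D(2) \<open>\<not> r \<le> s\<close> by simp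
  qed
  have flip: "r *\<^sub>R z - a \<in> Q \<or> a - r *\<^sub>R z \<in> Q" for r a
    using total[of "r *\<^sub>R z - a"] by simp
  have upper: "\<exists>s. a - s *\<^sub>R z \<in> Q" and lower: "\<exists>s. s *\<^sub>R z - a \<in> Q"
    if a: "a \<in> principal_ideal z" for a
  proof -
    obtain n where n: "\<bar>a\<bar> \<le> n *\<^sub>R z" using a by (auto simp: principal_ideal_def)
    then have "a - n *\<^sub>R z \<le> 0" using abs_le_D1 by auto
    with D(1,3) show "\<exists>s. a - s *\<^sub>R z \<in> Q" by blast
    have "(- n) *\<^sub>R z - a \<le> 0" using abs_le_D2[OF n] by (simp add: minus_le_iff)
    with D(1,3) show "\<exists>s. s *\<^sub>R z - a \<in> Q" by blast
  qed
  have ge: "r \<le> \<omega> a" if a: "a \<in> principal_ideal z" and r: "r *\<^sub>R z - a \<in> Q" for a r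
  proof -
    obtain s where "a - s *\<^sub>R z \<in> Q" using upper[OF a] by blast
    then have "bdd_above {r. r *\<^sub>R z - a \<in> Q}" using le by (intro bdd_aboveI[of _ s]) auto
    then show ?thesis unfolding \<omega>_def using r by (intro cSup_upper) auto
  qed
  have le\<omega>: "\<omega> a \<le> s" if "a \<in> principal_ideal z" "a - s *\<^sub>R z \<in> Q" for a s
    unfolding \<omega>_def using lower[OF that(1)] le[OF _ that(2)] by (intro cSup_least) auto
  \<comment> \<open>The cut point itself is not known to be attained on either side, so it is
    compared with \<open>a\<close> only up to a slack \<delta>.\<close>
  have below: "(\<omega> a - \<delta>) *\<^sub>R z - a \<in> Q" and above: "a - (\<omega> a + \<delta>) *\<^sub>R z \<in> Q"
    if "a \<in> principal_ideal z" "0 < \<delta>" for a \<delta>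
    using le\<omega>[OF that(1), of "\<omega> a - \<delta>"] ge[OF that(1), of "\<omega> a + \<delta>"] that(2)
      flip[of "\<omega> a - \<delta>" a] flip[of "\<omega> a + \<delta>" a] by auto
  \<comment> \<open>Conversely, two-sided comparison for every slack determines the value.
    Additivity, scaling by positive numbers, suprema and the value at \<open>z\<close> are all read
    off from this criterion.\<close>
  have eq: "\<omega> a = \<rho>" if a: "a \<in> principal_ideal z"
    and "\<And>\<delta>. 0 < \<delta> \<Longrightarrow> (\<rho> - \<delta>) *\<^sub>R z - a \<in> Q" "\<And>\<delta>. 0 < \<delta> \<Longrightarrow> a - (\<rho> + \<delta>) *\<^sub>R z \<in> Q" for a \<rho>
  proof (rule antisym)
    show "\<omega> a \<le> \<rho>" using le\<omega>[OF a that(3)] by (rule field_le_epsilon)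
    show "\<rho> \<le> \<omega> a"
    proof (rule field_le_epsilon)
      fix \<delta> :: real assume "0 < \<delta>"
      from ge[OF a that(2)[OF this]] show "\<rho> \<le> \<omega> a + \<delta>" by simp
    qed
  qed
  have add: "\<omega> (a + b) = \<omega> a + \<omega> b" if a: "a \<in> principal_ideal z" and b: "b \<in> principal_ideal z" for a b
  proof (rule eq[OF principal_ideal_add[OF a b]])
    fix \<delta> :: real assume "0 < \<delta>"
    then have \<delta>: "0 < \<delta> / 2" by simp
    have e: "\<delta> *\<^sub>R z = (\<delta> / 2) *\<^sub>R z + (\<delta> / 2) *\<^sub>R z" by (metis field_sum_of_halves scaleR_add_left)
    show "(\<omega> a + \<omega> b - \<delta>) *\<^sub>R z - (a + b) \<in> Q"
      using D(4)[OF below[OF a \<delta>] below[OF b \<delta>]] by (simp add: e algebra_simps)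
    show "a + b - (\<omega> a + \<omega> b + \<delta>) *\<^sub>R z \<in> Q"
      using D(4)[OF above[OF a \<delta>] above[OF b \<delta>]] by (simp add: e algebra_simps)
  qed
  have \<omega>0: "\<omega> 0 = 0"
    using add[of 0 0] principal_ideal_zero[OF z] by simp
  have pos: "\<omega> (r *\<^sub>R a) = r * \<omega> a" if a: "a \<in> principal_ideal z" and r: "0 \<le> r" for a r
  proof (cases "r = 0")
    case True
    then show ?thesis by (simp add: \<omega>0)
  next
    case False
    with r have r: "0 < r" by simp
    show ?thesis
    proof (rule eq[OF principal_ideal_scale[OF a]])
      fix \<delta> :: real assume "0 < \<delta>"
      with r have \<delta>: "0 < \<delta> / r" by simp
      show "(r * \<omega> a - \<delta>) *\<^sub>R z - r *\<^sub>R a \<in> Q"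
        using D(6)[OF below[OF a \<delta>], of r] r by (simp add: algebra_simps)
      show "r *\<^sub>R a - (r * \<omega> a + \<delta>) *\<^sub>R z \<in> Q"
        using D(6)[OF above[OF a \<delta>], of r] r by (simp add: algebra_simps)
    qed
  qed
  have scale: "\<omega> (r *\<^sub>R a) = r * \<omega> a" if a: "a \<in> principal_ideal z" for a r
  proof (cases "0 \<le> r")
    case False
    have "\<omega> (r *\<^sub>R a) + \<omega> ((- r) *\<^sub>R a) = 0"
      using add[OF principal_ideal_scale[OF a, of r] principal_ideal_scale[OF a, of "- r"]] \<omega>0 by simp
    then show ?thesis using pos[OF a, of "- r"] False by simp
  qed (rule pos[OF a])
  have sup: "\<omega> (sup a b) = max (\<omega> a) (\<omega> b)"
    if a: "a \<in> principal_ideal z" and b: "b \<in> principal_ideal z" for a b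
  proof (rule eq[OF principal_ideal_sup[OF a b]])
    fix \<delta> :: real assume \<delta>: "0 < \<delta>"
    \<comment> \<open>Whichever of \<open>a\<close> and \<open>b\<close> has the larger value
      supplies the bound, because the supremum dominates it.\<close>
    have "(max (\<omega> a) (\<omega> b) - \<delta>) *\<^sub>R z - sup a b \<le> (\<omega> a - \<delta>) *\<^sub>R z - a
      \<or> (max (\<omega> a) (\<omega> b) - \<delta>) *\<^sub>R z - sup a b \<le> (\<omega> b - \<delta>) *\<^sub>R z - b"
      by (cases "\<omega> a \<le> \<omega> b") (auto simp: max_def intro: diff_mono)
    then show "(max (\<omega> a) (\<omega> b) - \<delta>) *\<^sub>R z - sup a b \<in> Q"
      using below[OF a \<delta>] below[OF b \<delta>] D(3) by blast
    have "sup a b \<le> sup (a - (\<omega> a + \<delta>) *\<^sub>R z) (b - (\<omega> b + \<delta>) *\<^sub>R z) + (max (\<omega> a) (\<omega> b) + \<delta>) *\<^sub>R z"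
      (is "_ \<le> ?s + ?m")
    proof (rule sup_least)
      have "(a - (\<omega> a + \<delta>) *\<^sub>R z) + (\<omega> a + \<delta>) *\<^sub>R z \<le> ?s + ?m"
        using z by (intro add_mono scaleR_right_mono) auto
      then show "a \<le> ?s + ?m" by simp
      have "(b - (\<omega> b + \<delta>) *\<^sub>R z) + (\<omega> b + \<delta>) *\<^sub>R z \<le> ?s + ?m"
        using z by (intro add_mono scaleR_right_mono) auto
      then show "b \<le> ?s + ?m" by simp
    qed
    then have "sup a b - ?m \<le> ?s" by (simp add: algebra_simps)
    with D(3) D(5)[OF above[OF a \<delta>] above[OF b \<delta>]]
    show "sup a b - (max (\<omega> a) (\<omega> b) + \<delta>) *\<^sub>R z \<in> Q" by blast
  qed
  have "\<omega> z = 1"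
  proof (rule eq[OF principal_ideal_self[OF z]])
    fix \<delta> :: real assume "0 < \<delta>"
    with z have *: "- (\<delta> *\<^sub>R z) \<le> 0" by (simp add: scaleR_nonneg_nonneg)
    show "(1 - \<delta>) *\<^sub>R z - z \<in> Q" "z - (1 + \<delta>) *\<^sub>R z \<in> Q"
      using D(3)[OF D(1) *] by (simp_all add: algebra_simps)
  qed
  with add sup scale have "ideal_hom z \<omega>" by (simp add: ideal_hom_def)
  with ge that show thesis by blast
qed

section \<open>Separation by homomorphisms and basic neighbourhoods\<close>

lemma archimedean_epsilon:
  fixes s z :: "'v::archimedean_vector_lattice"
  assumes "0 \<le> z" "\<And>\<epsilon>. 0 < \<epsilon> \<Longrightarrow> s \<le> \<epsilon> *\<^sub>R z"
  shows "s \<le> 0"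
proof (rule archimedean)
  fix n :: nat
  show "real n *\<^sub>R s \<le> z"
  proof (cases "n = 0")
    case False
    then show ?thesis
      using scaleR_left_mono[OF assms(2)[of "1 / real n"], of "real n"] by simp
  qed (simp add: assms)
qed

text \<open>The Archimedean property gives \<epsilon> > 0 with \<open>s\<close> not below
  \<open>\<epsilon> *\<^sub>R z\<close>. The starting cone forces the positive part \<open>m\<close>
  of \<open>\<epsilon> *\<^sub>R z - s\<close> to be nonpositive. It omits \<open>z\<close>:
  otherwise the positive part \<open>p\<close> of \<open>s - \<epsilon> *\<^sub>R z\<close>, being
  bounded by a multiple of \<open>z\<close>, would be bounded by a multiple of \<open>m\<close>, and
  disjointness from \<open>m\<close> would make \<open>p\<close> vanish.\<close>

theorem ideal_hom_separates:
  fixes z s :: "'v::archimedean_vector_lattice"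
  assumes z: "0 \<le> z" and s: "s \<in> principal_ideal z" and pos: "\<not> s \<le> 0"
  obtains \<omega> where "ideal_hom z \<omega>" "0 < \<omega> s"
proof -
  obtain \<epsilon> where \<epsilon>: "0 < \<epsilon>" "\<not> s \<le> \<epsilon> *\<^sub>R z" using archimedean_epsilon[OF z, of s] pos by blast
  let ?p = "sup (s - \<epsilon> *\<^sub>R z) 0" and ?m = "sup (\<epsilon> *\<^sub>R z - s) 0"
  have disj: "inf ?p ?m = 0" using inf_pos_neg[of "s - \<epsilon> *\<^sub>R z"] by simp
  have p_in: "?p \<in> principal_ideal z"
    using s z by (intro principal_ideal_sup principal_ideal_diff principal_ideal_scale
        principal_ideal_self principal_ideal_zero)
  obtain N where N: "0 \<le> N" "\<bar>?p\<bar> \<le> N *\<^sub>R z" using principal_ideal_bound[OF p_in z] .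
  have z_m: "\<not> z \<le> r *\<^sub>R ?m" if r: "0 \<le> r" for r
  proof
    assume "z \<le> r *\<^sub>R ?m"
    from scaleR_left_mono[OF this N(1)] N(2) have "?p \<le> (N * r) *\<^sub>R ?m"
      using abs_ge_self[of ?p] by (metis order_trans scaleR_scaleR)
    \<comment> \<open>Adding 1 makes the coefficient invertible and at least 1, so that dividing
      \<open>?p\<close> by it gives an element below both \<open>?p\<close> and
      \<open>?m\<close>.\<close>
    also have "\<dots> \<le> (N * r + 1) *\<^sub>R ?m" by (intro scaleR_right_mono) auto
    finally have "?p \<le> (N * r + 1) *\<^sub>R ?m" (is "_ \<le> ?c *\<^sub>R _") .
    moreover have c: "1 \<le> ?c" using N(1) r by simp
    ultimately have "(1 / ?c) *\<^sub>R ?p \<le> (1 / ?c) *\<^sub>R (?c *\<^sub>R ?m)" by (intro scaleR_left_mono) auto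
    then have "(1 / ?c) *\<^sub>R ?p \<le> ?m" using c by simp
    moreover have "(1 / ?c) *\<^sub>R ?p \<le> 1 *\<^sub>R ?p" using c by (intro scaleR_right_mono) auto
    ultimately have "(1 / ?c) *\<^sub>R ?p \<le> inf ?p ?m" by simp
    then have "?c *\<^sub>R ((1 / ?c) *\<^sub>R ?p) \<le> ?c *\<^sub>R 0" unfolding disj using c by (intro scaleR_left_mono) auto
    then have "?p \<le> 0" using c by simp
    then show False using \<epsilon>(2) by simp
  qed
  have "ideal_cone z {a. a \<le> 0}"
    using z z_m[of 0] scaleR_left_mono[of _ "0 :: 'v"]
    by (auto simp: ideal_cone_def add_nonpos_nonpos intro: order_trans)
  then have "ideal_cone z {a. \<exists>q\<in>{a. a \<le> 0}. \<exists>r\<ge>0. a \<le> q + r *\<^sub>R ?m}" (is "ideal_cone z ?Q0")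
  proof (rule ideal_cone_extend)
    fix q :: 'v and r :: real assume "q \<in> {a. a \<le> 0}" "0 \<le> r"
    then show "\<not> z \<le> q + r *\<^sub>R ?m"
      using z_m[of r] add_right_mono[of q 0 "r *\<^sub>R ?m"] by (metis add_0 mem_Collect_eq order_trans)
  qed simp
  then obtain Q where Q: "ideal_cone z Q" "?Q0 \<subseteq> Q" "\<And>R. ideal_cone z R \<Longrightarrow> Q \<subseteq> R \<Longrightarrow> R = Q"
    using ideal_cone_maximal_exists by blast
  obtain \<omega> where \<omega>: "ideal_hom z \<omega>" "\<And>a r. a \<in> principal_ideal z \<Longrightarrow> r *\<^sub>R z - a \<in> Q \<Longrightarrow> r \<le> \<omega> a"
    using ideal_cone_maximal_hom[OF Q(1) ideal_cone_maximal_total[OF Q(1,3)] z] by blast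
  \<comment> \<open>This element lies below its positive part \<open>?m\<close>, hence in the
    starting cone; the cut property then gives \<open>\<epsilon> \<le> \<omega> s\<close>.\<close>
  have "\<epsilon> *\<^sub>R z - s \<in> ?Q0" by (auto intro!: exI[of _ 0] exI[of _ 1])
  with Q(2) \<omega>(2)[OF s] \<epsilon>(1) have "0 < \<omega> s" by fastforce
  with \<omega>(1) that show thesis by blast
qed

lemma ideal_homD:
  fixes \<omega> :: "'v::vector_lattice \<Rightarrow> real"
  assumes \<omega>: "ideal_hom z \<omega>" and z: "0 \<le> z"
  shows "\<omega> z = 1"
    "\<And>a b. a \<in> principal_ideal z \<Longrightarrow> b \<in> principal_ideal z \<Longrightarrow> \<omega> (a + b) = \<omega> a + \<omega> b"
    "\<And>a b. a \<in> principal_ideal z \<Longrightarrow> b \<in> principal_ideal z \<Longrightarrow> \<omega> (a - b) = \<omega> a - \<omega> b"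
    "\<And>a b. a \<in> principal_ideal z \<Longrightarrow> b \<in> principal_ideal z \<Longrightarrow> \<omega> (sup a b) = max (\<omega> a) (\<omega> b)"
    "\<And>a r. a \<in> principal_ideal z \<Longrightarrow> \<omega> (r *\<^sub>R a) = r * \<omega> a"
    "\<And>a. a \<in> principal_ideal z \<Longrightarrow> \<omega> \<bar>a\<bar> = \<bar>\<omega> a\<bar>"
    "\<And>a b. a \<in> principal_ideal z \<Longrightarrow> b \<in> principal_ideal z \<Longrightarrow> a \<le> b \<Longrightarrow> \<omega> a \<le> \<omega> b"
    "\<omega> 0 = 0"
proof -
  show one: "\<omega> z = 1"
    and add: "\<And>a b. a \<in> principal_ideal z \<Longrightarrow> b \<in> principal_ideal z \<Longrightarrow> \<omega> (a + b) = \<omega> a + \<omega> b"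
    and sup: "\<And>a b. a \<in> principal_ideal z \<Longrightarrow> b \<in> principal_ideal z \<Longrightarrow> \<omega> (sup a b) = max (\<omega> a) (\<omega> b)"
    and scale: "\<And>a r. a \<in> principal_ideal z \<Longrightarrow> \<omega> (r *\<^sub>R a) = r * \<omega> a"
    using \<omega> by (auto simp: ideal_hom_def)
  have minus: "\<omega> (- a) = - \<omega> a" if "a \<in> principal_ideal z" for a
    using scale[OF that, of "- 1"] by simp
  show "\<omega> (a - b) = \<omega> a - \<omega> b" if "a \<in> principal_ideal z" "b \<in> principal_ideal z" for a b
    using add[OF that(1) principal_ideal_uminus[OF that(2)]] minus[OF that(2)] by simp
  show "\<omega> \<bar>a\<bar> = \<bar>\<omega> a\<bar>" if "a \<in> principal_ideal z" for a
    using sup[OF that principal_ideal_uminus[OF that]] minus[OF that]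
    by (simp add: abs_lattice[where 'a='v] max_def)
  show "\<omega> a \<le> \<omega> b" if "a \<in> principal_ideal z" "b \<in> principal_ideal z" "a \<le> b" for a b
    using sup[OF that(1,2)] sup.absorb2[OF that(3)] by simp
  show "\<omega> 0 = 0" using scale[OF principal_ideal_zero[OF z], of 0] by simp
qed

lemma ideal_hom_inf:
  fixes \<omega> :: "'v::vector_lattice \<Rightarrow> real"
  assumes "ideal_hom z \<omega>" "0 \<le> z" "a \<in> principal_ideal z" "b \<in> principal_ideal z"
  shows "\<omega> (inf a b) = min (\<omega> a) (\<omega> b)"
proof -
  note D = ideal_homD[OF assms(1,2)]
  have "inf a b = 0 - sup (0 - a) (0 - b)" by simp
  then show ?thesis
    using assms(2-) by (simp only: D principal_ideal_diff principal_ideal_sup principal_ideal_zero)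
qed

text \<open>Separation applied to \<open>a - b\<close>. It makes the order on a principal ideal
  pointwise over the homomorphisms, so inequalities can be checked as for real functions.\<close>

lemma ideal_hom_leI:
  fixes a b z :: "'v::archimedean_vector_lattice"
  assumes z: "0 \<le> z" and ab: "a \<in> principal_ideal z" "b \<in> principal_ideal z"
    and le: "\<And>\<omega>. ideal_hom z \<omega> \<Longrightarrow> \<omega> a \<le> \<omega> b"
  shows "a \<le> b"
proof (rule ccontr)
  assume "\<not> a \<le> b"
  then have "\<not> a - b \<le> 0" by simp
  then obtain \<omega> where "ideal_hom z \<omega>" "0 < \<omega> (a - b)"
    using ideal_hom_separates[OF z principal_ideal_diff[OF ab]] by blast
  then show False using le ideal_homD(3)[OF _ z ab] by fastforce
qed

text \<open>The witness is the positive part of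
  \<open>\<delta> *\<^sub>R z - \<bar>a - \<phi> a *\<^sub>R z\<bar>\<close>: its value at \<psi> is
  positive exactly when \<psi> is \<delta>-close to \<phi> on \<open>a\<close>. The bound
  \<open>\<delta> \<le> 1\<close> keeps it below \<open>z\<close>.\<close>

lemma ideal_hom_neighbourhood:
  assumes z: "0 \<le> z" and \<phi>: "ideal_hom z \<phi>" and a: "a \<in> principal_ideal z" and \<delta>: "0 < \<delta>" "\<delta> \<le> 1"
  obtains x where "x \<in> {0..z}" "0 < \<phi> x"
    "\<And>\<psi>. ideal_hom z \<psi> \<Longrightarrow> 0 < \<psi> x \<Longrightarrow> \<bar>\<psi> a - \<phi> a\<bar> < \<delta>"
proof
  let ?x = "sup (\<delta> *\<^sub>R z - \<bar>a - \<phi> a *\<^sub>R z\<bar>) 0"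
  have val: "\<psi> ?x = max (\<delta> - \<bar>\<psi> a - \<phi> a\<bar>) 0" if "ideal_hom z \<psi>" for \<psi>
    by (simp add: ideal_homD[OF that z] principal_ideal_diff principal_ideal_scale a
        principal_ideal_self[OF z] principal_ideal_abs principal_ideal_zero[OF z])
  have "\<delta> *\<^sub>R z \<le> 1 *\<^sub>R z" using \<delta> z by (intro scaleR_right_mono) auto
  then have "\<delta> *\<^sub>R z - \<bar>a - \<phi> a *\<^sub>R z\<bar> \<le> z" by (auto simp: diff_le_eq intro: add_increasing2)
  with z show "?x \<in> {0..z}" by simp
  show "0 < \<phi> ?x" using val[OF \<phi>] \<delta>(1) by simp
  show "\<bar>\<psi> a - \<phi> a\<bar> < \<delta>" if "ideal_hom z \<psi>" "0 < \<psi> ?x" for \<psi>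
    using val[OF that(1)] that(2) by simp
qed

section \<open>Lattice bimorphisms\<close>

locale bimorphism =
  fixes tn :: "'e::vector_lattice \<Rightarrow> 'f::vector_lattice \<Rightarrow> 't::vector_lattice" (infixl "\<otimes>" 70)
  assumes bimorphism: "lattice_bimorphism class_vlat tn"
begin

lemma add_left: "(a + b) \<otimes> c = a \<otimes> c + b \<otimes> c"
  and add_right: "a' \<otimes> (b' + c') = a' \<otimes> b' + a' \<otimes> c'"
  and scale_left: "(r *\<^sub>R a) \<otimes> c = r *\<^sub>R (a \<otimes> c)"
  and scale_right: "a' \<otimes> (r *\<^sub>R c') = r *\<^sub>R (a' \<otimes> c')"
  and sup_left: "0 \<le> c \<Longrightarrow> sup a b \<otimes> c = sup (a \<otimes> c) (b \<otimes> c)"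
  and sup_right: "0 \<le> a' \<Longrightarrow> a' \<otimes> sup b' c' = sup (a' \<otimes> b') (a' \<otimes> c')"
  using bimorphism unfolding lattice_bimorphism_def lattice_hom_def by auto

lemma minus_left: "(- a) \<otimes> c = - (a \<otimes> c)"
  using scale_left[of "- 1" a c] by simp

lemma minus_right: "a \<otimes> (- c) = - (a \<otimes> c)"
  using scale_right[of a "- 1" c] by simp

lemma zero_left [simp]: "0 \<otimes> c = 0"
  using scale_left[of 0 0 c] by simp

lemma zero_right [simp]: "a \<otimes> 0 = 0"
  using scale_right[of a 0 0] by simp

lemma diff_left: "(a - b) \<otimes> c = a \<otimes> c - b \<otimes> c"
  using add_left[of a "- b" c] by (simp add: minus_left)

lemma mono_left: "0 \<le> c \<Longrightarrow> a \<le> b \<Longrightarrow> a \<otimes> c \<le> b \<otimes> c"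
  using sup_left[of c a b] by (metis sup.absorb_iff2)

lemma mono_right: "0 \<le> c \<Longrightarrow> a \<le> b \<Longrightarrow> c \<otimes> a \<le> c \<otimes> b"
  using sup_right[of c a b] by (metis sup.absorb_iff2)

lemma mono: "0 \<le> a \<Longrightarrow> a \<le> b \<Longrightarrow> 0 \<le> c \<Longrightarrow> c \<le> d \<Longrightarrow> a \<otimes> c \<le> b \<otimes> d"
  by (meson mono_left mono_right order_trans)

lemma nonneg: "0 \<le> a \<Longrightarrow> 0 \<le> b \<Longrightarrow> 0 \<le> a \<otimes> b"
  using mono_left[of b 0 a] by simp

lemma abs_left: "0 \<le> c \<Longrightarrow> \<bar>a \<otimes> c\<bar> = \<bar>a\<bar> \<otimes> c"
  by (simp add: abs_lattice[where 'a='e] abs_lattice[where 'a='t] sup_left minus_left)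

text \<open>Splitting \<open>b\<close> into positive and negative parts leaves nonnegative right
  factors, for which \<open>abs_left\<close> is an equality; the triangle inequality does the
  rest.\<close>

lemma abs_le: "\<bar>a \<otimes> b\<bar> \<le> \<bar>a\<bar> \<otimes> \<bar>b\<bar>"
proof -
  have "\<bar>a \<otimes> b\<bar> = \<bar>a \<otimes> pprt b - a \<otimes> (- nprt b)\<bar>"
    by (simp add: minus_right flip: add_right prts)
  also have "\<dots> \<le> \<bar>a \<otimes> pprt b\<bar> + \<bar>a \<otimes> (- nprt b)\<bar>" by (rule abs_triangle_ineq4)
  also have "\<dots> = \<bar>a\<bar> \<otimes> (pprt b + (- nprt b))"
    by (simp only: abs_left add_right zero_le_pprt nprt_le_zero neg_0_le_iff_le)
  also have "\<dots> = \<bar>a\<bar> \<otimes> \<bar>b\<bar>" by (simp add: abs_prts)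
  finally show ?thesis .
qed

lemma mem_ideal:
  assumes "0 \<le> e" "0 \<le> f" "a \<in> principal_ideal e" "b \<in> principal_ideal f"
  shows "a \<otimes> b \<in> principal_ideal (e \<otimes> f)"
proof -
  obtain n m where nm: "0 \<le> n" "\<bar>a\<bar> \<le> n *\<^sub>R e" "0 \<le> m" "\<bar>b\<bar> \<le> m *\<^sub>R f"
    using assms by (meson principal_ideal_bound)
  have "\<bar>a \<otimes> b\<bar> \<le> \<bar>a\<bar> \<otimes> \<bar>b\<bar>" by (rule abs_le)
  also have "\<dots> \<le> (n *\<^sub>R e) \<otimes> (m *\<^sub>R f)" using nm by (intro mono) auto
  also have "\<dots> = (n * m) *\<^sub>R (e \<otimes> f)" by (simp add: scale_left scale_right mult.commute)
  finally show ?thesis by (auto simp: principal_ideal_def)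
qed

section \<open>Homomorphisms on the ideal of an elementary tensor\<close>

context
  fixes e f and \<omega> :: "'t \<Rightarrow> real"
  assumes e: "0 \<le> e" and f: "0 \<le> f" and \<omega>: "ideal_hom (e \<otimes> f) \<omega>"
begin

lemma hom_left: "ideal_hom e (\<lambda>a. \<omega> (a \<otimes> f))"
  using ideal_homD[OF \<omega> nonneg[OF e f]] mem_ideal[OF e f _ principal_ideal_self[OF f]]
  by (simp add: ideal_hom_def add_left scale_left sup_left[OF f])

lemma hom_right: "ideal_hom f (\<lambda>b. \<omega> (e \<otimes> b))"
  using ideal_homD[OF \<omega> nonneg[OF e f]] mem_ideal[OF e f principal_ideal_self[OF e]]
  by (simp add: ideal_hom_def add_right scale_right sup_right[OF e])

text \<open>Subtracting from \<open>a\<close> the multiple of \<open>e\<close> with the same value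
  leaves \<open>c\<close> with \<omega> vanishing on \<open>\<bar>c\<bar> \<otimes> f\<close>. As
  \<open>b\<close> is bounded by a multiple of \<open>f\<close>, \<omega> also vanishes on
  \<open>c \<otimes> b\<close>, and only the multiple of \<open>e \<otimes> b\<close>
  contributes.\<close>

lemma hom_product:
  assumes a: "a \<in> principal_ideal e" and b: "b \<in> principal_ideal f"
  shows "\<omega> (a \<otimes> b) = \<omega> (a \<otimes> f) * \<omega> (e \<otimes> b)"
proof -
  note D = ideal_homD[OF \<omega> nonneg[OF e f]]
  note L = ideal_homD[OF hom_left e]
  define c where "c = a - \<omega> (a \<otimes> f) *\<^sub>R e"
  have c: "c \<in> principal_ideal e"
    unfolding c_def by (intro principal_ideal_diff principal_ideal_scale principal_ideal_self a e)
  note self = principal_ideal_self[OF e] principal_ideal_self[OF f]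
  obtain n where n: "0 \<le> n" "\<bar>b\<bar> \<le> n *\<^sub>R f" using principal_ideal_bound[OF b f] .
  have "\<omega> (c \<otimes> f) = 0"
    unfolding c_def by (simp add: L a principal_ideal_scale self)
  then have c0: "\<omega> (\<bar>c\<bar> \<otimes> f) = 0" using L(6)[OF c] by simp
  have "\<bar>c \<otimes> b\<bar> \<le> \<bar>c\<bar> \<otimes> (n *\<^sub>R f)"
    by (rule order_trans[OF abs_le mono_right]) (use n in auto)
  then have "\<omega> \<bar>c \<otimes> b\<bar> \<le> \<omega> (\<bar>c\<bar> \<otimes> (n *\<^sub>R f))"
    by (intro D(7) principal_ideal_abs mem_ideal e f c b principal_ideal_scale self)
  also have "\<dots> = n * \<omega> (\<bar>c\<bar> \<otimes> f)"
    unfolding scale_right by (intro D(5) mem_ideal e f principal_ideal_abs c self)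
  also have "\<dots> = 0" using c0 by simp
  finally have "\<omega> (c \<otimes> b) = 0" using D(6)[OF mem_ideal[OF e f c b]] by simp
  moreover have "a \<otimes> b = c \<otimes> b + \<omega> (a \<otimes> f) *\<^sub>R (e \<otimes> b)"
    by (simp add: c_def diff_left scale_left)
  moreover have "\<omega> (c \<otimes> b + \<omega> (a \<otimes> f) *\<^sub>R (e \<otimes> b)) = \<omega> (c \<otimes> b) + \<omega> (a \<otimes> f) * \<omega> (e \<otimes> b)"
    by (simp add: D mem_ideal e f c b self principal_ideal_scale)
  ultimately show ?thesis by simp
qed

end

text \<open>Continuity of \<open>\<omega> \<mapsto> \<omega> w\<close> on the homomorphisms on the ideal of \<open>e \<otimes> f\<close>, where the sets
  \<open>{\<omega>. 0 < \<omega> (x \<otimes> y)}\<close> serve as basic neighbourhoods.\<close>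

definition tensor_continuous :: "'e \<Rightarrow> 'f \<Rightarrow> 't \<Rightarrow> bool" where
  "tensor_continuous e f w \<longleftrightarrow> w \<in> principal_ideal (e \<otimes> f) \<and>
    (\<forall>\<omega> \<epsilon>. ideal_hom (e \<otimes> f) \<omega> \<longrightarrow> 0 < \<epsilon> \<longrightarrow>
      (\<exists>x y. x \<in> {0..e} \<and> y \<in> {0..f} \<and> 0 < \<omega> (x \<otimes> y) \<and>
        (\<forall>\<omega>'. ideal_hom (e \<otimes> f) \<omega>' \<longrightarrow> 0 < \<omega>' (x \<otimes> y) \<longrightarrow> \<bar>\<omega>' w - \<omega> w\<bar> < \<epsilon>)))"

text \<open>By \<open>hom_product\<close> the value at the tensor of infima is a product of two
  minima, positive iff all four factors are. Hence the basic neighbourhoods are closed under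
  intersection.\<close>

lemma neighbourhood_inf:
  assumes e: "0 \<le> e" and f: "0 \<le> f" and \<omega>: "ideal_hom (e \<otimes> f) \<omega>"
    and xy: "x \<in> {0..e}" "y \<in> {0..f}" "x' \<in> {0..e}" "y' \<in> {0..f}"
  shows "0 < \<omega> (inf x x' \<otimes> inf y y') \<longleftrightarrow> 0 < \<omega> (x \<otimes> y) \<and> 0 < \<omega> (x' \<otimes> y')"
proof -
  note L = hom_left[OF e f \<omega>] and R = hom_right[OF e f \<omega>]
  have I: "x \<in> principal_ideal e" "x' \<in> principal_ideal e" "inf x x' \<in> principal_ideal e"
    "y \<in> principal_ideal f" "y' \<in> principal_ideal f" "inf y y' \<in> principal_ideal f"
    using xy by (auto intro!: principal_idealI[of _ 1] intro: le_infI1)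
  have nn: "0 \<le> \<omega> (a \<otimes> f)" if "a \<in> {0..e}" for a
    using that ideal_homD(7,8)[OF L e] by (metis atLeastAtMost_iff principal_idealI principal_ideal_zero e scaleR_one)
  have nn': "0 \<le> \<omega> (e \<otimes> a)" if "a \<in> {0..f}" for a
    using that ideal_homD(7,8)[OF R f] by (metis atLeastAtMost_iff principal_idealI principal_ideal_zero f scaleR_one)
  \<comment> \<open>Nonnegativity excludes a positive product of two negative factors.\<close>
  have pos: "0 < p * q \<longleftrightarrow> 0 < p \<and> 0 < q" if "0 \<le> p" "0 \<le> q" for p q :: real
    using that by (auto simp: zero_less_mult_iff)
  show ?thesis
    by (simp add: hom_product[OF e f \<omega> I(1,4)] hom_product[OF e f \<omega> I(2,5)]
        hom_product[OF e f \<omega> I(3,6)] I ideal_hom_inf[OF L e] ideal_hom_inf[OF R f]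
        pos nn[OF xy(1)] nn[OF xy(3)] nn'[OF xy(2)] nn'[OF xy(4)]) blast
qed

text \<open>A Lipschitz bound in the values of \<open>w\<close> and \<open>w'\<close> transfers
  continuity to \<open>g\<close>, treating sums, multiples and suprema uniformly.\<close>

lemma tensor_continuous_comb:
  assumes e: "0 \<le> e" and f: "0 \<le> f"
    and w: "tensor_continuous e f w" "tensor_continuous e f w'"
    and g: "g \<in> principal_ideal (e \<otimes> f)" and K: "0 < K"
    and le: "\<And>\<omega> \<omega>'. ideal_hom (e \<otimes> f) \<omega> \<Longrightarrow> ideal_hom (e \<otimes> f) \<omega>' \<Longrightarrow>
      \<bar>\<omega>' g - \<omega> g\<bar> \<le> K * (\<bar>\<omega>' w - \<omega> w\<bar> + \<bar>\<omega>' w' - \<omega> w'\<bar>)"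
  shows "tensor_continuous e f g"
  unfolding tensor_continuous_def
proof (intro conjI allI impI g)
  fix \<omega> and \<epsilon> :: real
  assume \<omega>: "ideal_hom (e \<otimes> f) \<omega>" and "0 < \<epsilon>"
  with K have \<delta>: "0 < \<epsilon> / (2 * K)" by simp
  obtain x y where xy: "x \<in> {0..e}" "y \<in> {0..f}" "0 < \<omega> (x \<otimes> y)"
    "\<And>\<omega>'. ideal_hom (e \<otimes> f) \<omega>' \<Longrightarrow> 0 < \<omega>' (x \<otimes> y) \<Longrightarrow> \<bar>\<omega>' w - \<omega> w\<bar> < \<epsilon> / (2 * K)"
    using w(1) \<omega> \<delta> unfolding tensor_continuous_def by metis
  obtain x' y' where xy': "x' \<in> {0..e}" "y' \<in> {0..f}" "0 < \<omega> (x' \<otimes> y')"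
    "\<And>\<omega>'. ideal_hom (e \<otimes> f) \<omega>' \<Longrightarrow> 0 < \<omega>' (x' \<otimes> y') \<Longrightarrow> \<bar>\<omega>' w' - \<omega> w'\<bar> < \<epsilon> / (2 * K)"
    using w(2) \<omega> \<delta> unfolding tensor_continuous_def by metis
  note nbh = neighbourhood_inf[OF e f _ xy(1,2) xy'(1,2)]
  show "\<exists>x y. x \<in> {0..e} \<and> y \<in> {0..f} \<and> 0 < \<omega> (x \<otimes> y) \<and>
    (\<forall>\<omega>'. ideal_hom (e \<otimes> f) \<omega>' \<longrightarrow> 0 < \<omega>' (x \<otimes> y) \<longrightarrow> \<bar>\<omega>' g - \<omega> g\<bar> < \<epsilon>)"
  proof (intro exI[of _ "inf x x'"] exI[of _ "inf y y'"] conjI allI impI)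
    show "inf x x' \<in> {0..e}" "inf y y' \<in> {0..f}" using xy xy' by (auto intro: le_infI1)
    show "0 < \<omega> (inf x x' \<otimes> inf y y')" using nbh[OF \<omega>] xy(3) xy'(3) by blast
    fix \<omega>' assume \<omega>': "ideal_hom (e \<otimes> f) \<omega>'" and "0 < \<omega>' (inf x x' \<otimes> inf y y')"
    then have "\<bar>\<omega>' w - \<omega> w\<bar> + \<bar>\<omega>' w' - \<omega> w'\<bar> < \<epsilon> / (2 * K) + \<epsilon> / (2 * K)"
      using nbh xy(4) xy'(4) by (intro add_strict_mono) blast+
    then have "K * (\<bar>\<omega>' w - \<omega> w\<bar> + \<bar>\<omega>' w' - \<omega> w'\<bar>) < K * (\<epsilon> / (2 * K) + \<epsilon> / (2 * K))"
      using K by (intro mult_strict_left_mono)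
    also have "\<dots> = \<epsilon>" using K by (simp add: field_simps)
    finally show "\<bar>\<omega>' g - \<omega> g\<bar> < \<epsilon>" using le[OF \<omega> \<omega>'] by linarith
  qed
qed

text \<open>By \<open>hom_product\<close> the value at \<open>a \<otimes> b\<close> is a product of
  two factors, each continuous by \<open>ideal_hom_neighbourhood\<close> and bounded by 1 because
  \<open>\<bar>a\<bar> \<le> e\<close> and \<open>\<bar>b\<bar> \<le> f\<close>.\<close>

lemma tensor_continuous_tensor:
  assumes e: "\<bar>a\<bar> \<le> e" and f: "\<bar>b\<bar> \<le> f"
  shows "tensor_continuous e f (a \<otimes> b)"
proof -
  have e0: "0 \<le> e" and f0: "0 \<le> f" using order_trans[OF abs_ge_zero e] order_trans[OF abs_ge_zero f] .
  have a: "a \<in> principal_ideal e" and b: "b \<in> principal_ideal f"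
    using e f by (auto simp: principal_ideal_def intro: exI[of _ 1])
  show ?thesis
    unfolding tensor_continuous_def
  proof (intro conjI allI impI mem_ideal e0 f0 a b)
    fix \<omega> and \<epsilon> :: real
    assume \<omega>: "ideal_hom (e \<otimes> f) \<omega>" and \<epsilon>: "0 < \<epsilon>"
    define \<delta> where "\<delta> = min 1 (\<epsilon> / 2)"
    have \<delta>: "0 < \<delta>" "\<delta> \<le> 1" "2 * \<delta> \<le> \<epsilon>" using \<epsilon> by (auto simp: \<delta>_def)
    have le1: "\<bar>\<omega>' (a \<otimes> f)\<bar> \<le> 1" "\<bar>\<omega>' (e \<otimes> b)\<bar> \<le> 1" if "ideal_hom (e \<otimes> f) \<omega>'" for \<omega>'
      using ideal_homD(1,6,7)[OF hom_left[OF e0 f0 that] e0] ideal_homD(1,6,7)[OF hom_right[OF e0 f0 that] f0]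
        a b e f principal_ideal_abs principal_ideal_self e0 f0 by metis+
    obtain x where x: "x \<in> {0..e}" "0 < \<omega> (x \<otimes> f)"
      "\<And>\<psi>. ideal_hom e \<psi> \<Longrightarrow> 0 < \<psi> x \<Longrightarrow> \<bar>\<psi> a - \<omega> (a \<otimes> f)\<bar> < \<delta>"
      using ideal_hom_neighbourhood[OF e0 hom_left[OF e0 f0 \<omega>] a \<delta>(1,2)] by blast
    obtain y where y: "y \<in> {0..f}" "0 < \<omega> (e \<otimes> y)"
      "\<And>\<psi>. ideal_hom f \<psi> \<Longrightarrow> 0 < \<psi> y \<Longrightarrow> \<bar>\<psi> b - \<omega> (e \<otimes> b)\<bar> < \<delta>"
      using ideal_hom_neighbourhood[OF f0 hom_right[OF e0 f0 \<omega>] b \<delta>(1,2)] by blast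
    have I: "x \<in> principal_ideal e" "y \<in> principal_ideal f"
      using x(1) y(1) by (auto intro: principal_idealI[of _ 1])
    show "\<exists>x y. x \<in> {0..e} \<and> y \<in> {0..f} \<and> 0 < \<omega> (x \<otimes> y) \<and>
      (\<forall>\<omega>'. ideal_hom (e \<otimes> f) \<omega>' \<longrightarrow> 0 < \<omega>' (x \<otimes> y) \<longrightarrow> \<bar>\<omega>' (a \<otimes> b) - \<omega> (a \<otimes> b)\<bar> < \<epsilon>)"
    proof (intro exI[of _ x] exI[of _ y] conjI allI impI x(1) y(1))
      show "0 < \<omega> (x \<otimes> y)" using x(2) y(2) by (simp add: hom_product[OF e0 f0 \<omega> I])
      fix \<omega>' assume \<omega>': "ideal_hom (e \<otimes> f) \<omega>'" and pos: "0 < \<omega>' (x \<otimes> y)"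
      have "0 \<le> \<omega>' (x \<otimes> f)"
        using ideal_homD(7,8)[OF hom_left[OF e0 f0 \<omega>'] e0] x(1) I(1) principal_ideal_zero[OF e0]
        by (metis atLeastAtMost_iff)
      moreover have "\<omega>' (x \<otimes> y) = \<omega>' (x \<otimes> f) * \<omega>' (e \<otimes> y)"
        by (rule hom_product[OF e0 f0 \<omega>' I])
      ultimately have "0 < \<omega>' (x \<otimes> f)" "0 < \<omega>' (e \<otimes> y)"
        using pos by (auto simp: zero_less_mult_iff)
      then have *: "\<bar>\<omega>' (a \<otimes> f) - \<omega> (a \<otimes> f)\<bar> < \<delta>" "\<bar>\<omega>' (e \<otimes> b) - \<omega> (e \<otimes> b)\<bar> < \<delta>"
        using x(3)[OF hom_left[OF e0 f0 \<omega>']] y(3)[OF hom_right[OF e0 f0 \<omega>']] by auto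
      have "\<omega>' (a \<otimes> b) - \<omega> (a \<otimes> b) = (\<omega>' (a \<otimes> f) - \<omega> (a \<otimes> f)) * \<omega>' (e \<otimes> b)
          + \<omega> (a \<otimes> f) * (\<omega>' (e \<otimes> b) - \<omega> (e \<otimes> b))"
        by (simp add: hom_product[OF e0 f0 \<omega> a b] hom_product[OF e0 f0 \<omega>' a b] algebra_simps)
      also have "\<bar>\<dots>\<bar> \<le> \<bar>\<omega>' (a \<otimes> f) - \<omega> (a \<otimes> f)\<bar> * 1 + 1 * \<bar>\<omega>' (e \<otimes> b) - \<omega> (e \<otimes> b)\<bar>"
        by (intro order_trans[OF abs_triangle_ineq] add_mono)
          (auto simp: abs_mult intro!: mult_left_le mult_left_le_one_le le1[OF \<omega>'] le1[OF \<omega>])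
      also have "\<dots> < \<epsilon>" using * \<delta>(3) by simp
      finally show "\<bar>\<omega>' (a \<otimes> b) - \<omega> (a \<otimes> b)\<bar> < \<epsilon>" .
    qed
  qed
qed

text \<open>Induction over the generated sublattice. The predicate demands continuity for all
  sufficiently large \<open>e\<close> and \<open>f\<close>, since two elements can be combined only
  over a common pair.\<close>

lemma tensor_continuous_generated:
  assumes gen: "w \<in> vector_sublattice hull {x \<otimes> y | x y. True}"
  obtains e0 f0 where "0 \<le> e0" "0 \<le> f0" "\<And>e f. e0 \<le> e \<Longrightarrow> f0 \<le> f \<Longrightarrow> tensor_continuous e f w"
proof -
  define P where "P w \<longleftrightarrow> (\<exists>e0 f0. 0 \<le> e0 \<and> 0 \<le> f0 \<and> (\<forall>e\<ge>e0. \<forall>f\<ge>f0. tensor_continuous e f w))" for w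
  have tensor: "P (a \<otimes> b)" for a b
    unfolding P_def by (auto intro!: exI[of _ "\<bar>a\<bar>"] exI[of _ "\<bar>b\<bar>"] tensor_continuous_tensor)
  have comb: "P g" if "P w" "P w'" and K: "0 < K"
    and I: "\<And>e f. 0 \<le> e \<Longrightarrow> 0 \<le> f \<Longrightarrow> w \<in> principal_ideal (e \<otimes> f) \<Longrightarrow>
      w' \<in> principal_ideal (e \<otimes> f) \<Longrightarrow> g \<in> principal_ideal (e \<otimes> f)"
    and le: "\<And>e f \<omega> \<omega>'. 0 \<le> e \<Longrightarrow> 0 \<le> f \<Longrightarrow> w \<in> principal_ideal (e \<otimes> f) \<Longrightarrow>
      w' \<in> principal_ideal (e \<otimes> f) \<Longrightarrow> ideal_hom (e \<otimes> f) \<omega> \<Longrightarrow> ideal_hom (e \<otimes> f) \<omega>' \<Longrightarrow>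
      \<bar>\<omega>' g - \<omega> g\<bar> \<le> K * (\<bar>\<omega>' w - \<omega> w\<bar> + \<bar>\<omega>' w' - \<omega> w'\<bar>)" for w w' g K
  proof -
    obtain e1 f1 where 1: "0 \<le> e1" "0 \<le> f1" "\<And>e f. e1 \<le> e \<Longrightarrow> f1 \<le> f \<Longrightarrow> tensor_continuous e f w"
      using \<open>P w\<close> unfolding P_def by blast
    obtain e2 f2 where 2: "0 \<le> e2" "0 \<le> f2" "\<And>e f. e2 \<le> e \<Longrightarrow> f2 \<le> f \<Longrightarrow> tensor_continuous e f w'"
      using \<open>P w'\<close> unfolding P_def by blast
    show ?thesis
      unfolding P_def
    proof (intro exI[of _ "sup e1 e2"] exI[of _ "sup f1 f2"] conjI allI impI)
      show "0 \<le> sup e1 e2" "0 \<le> sup f1 f2" using 1 2 by (auto intro: le_supI1)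
      fix e f assume ef: "sup e1 e2 \<le> e" "sup f1 f2 \<le> f"
      then have w: "tensor_continuous e f w" "tensor_continuous e f w'" using 1(3) 2(3) by auto
      have nn: "0 \<le> e" "0 \<le> f" using ef 1 by (auto intro: order_trans)
      have mem: "w \<in> principal_ideal (e \<otimes> f)" "w' \<in> principal_ideal (e \<otimes> f)"
        using w by (auto simp: tensor_continuous_def)
      show "tensor_continuous e f g"
        by (rule tensor_continuous_comb[OF nn w I[OF nn mem] K le[OF nn mem]])
    qed
  qed
  have add: "P (v + w)" if "P v" "P w" for v w
    using that
  proof (rule comb[of _ _ 1])
    fix e f \<omega> \<omega>'
    assume nn: "0 \<le> e" "0 \<le> f" and I: "v \<in> principal_ideal (e \<otimes> f)" "w \<in> principal_ideal (e \<otimes> f)"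
      and h: "ideal_hom (e \<otimes> f) \<omega>" "ideal_hom (e \<otimes> f) \<omega>'"
    show "\<bar>\<omega>' (v + w) - \<omega> (v + w)\<bar> \<le> 1 * (\<bar>\<omega>' v - \<omega> v\<bar> + \<bar>\<omega>' w - \<omega> w\<bar>)"
      unfolding h[THEN ideal_homD(2)[OF _ nonneg[OF nn] I]] mult_1_left by linarith
  qed (auto intro: principal_ideal_add)
  \<comment> \<open>The same element fills both slots of \<open>comb\<close>; the added 1 keeps the
    constant positive when \<open>r = 0\<close>.\<close>
  have scale: "P (r *\<^sub>R v)" if "P v" for v r
    using that that
  proof (rule comb[of _ _ "\<bar>r\<bar> + 1"])
    fix e f \<omega> \<omega>'
    assume nn: "0 \<le> e" "0 \<le> f" and I: "v \<in> principal_ideal (e \<otimes> f)"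
      and h: "ideal_hom (e \<otimes> f) \<omega>" "ideal_hom (e \<otimes> f) \<omega>'"
    have "\<bar>\<omega>' (r *\<^sub>R v) - \<omega> (r *\<^sub>R v)\<bar> = \<bar>r\<bar> * \<bar>\<omega>' v - \<omega> v\<bar>"
      unfolding h[THEN ideal_homD(5)[OF _ nonneg[OF nn] I]] by (simp flip: right_diff_distrib add: abs_mult)
    also have "\<dots> \<le> (\<bar>r\<bar> + 1) * (\<bar>\<omega>' v - \<omega> v\<bar> + \<bar>\<omega>' v - \<omega> v\<bar>)"
      by (intro mult_mono) auto
    finally show "\<bar>\<omega>' (r *\<^sub>R v) - \<omega> (r *\<^sub>R v)\<bar> \<le> (\<bar>r\<bar> + 1) * (\<bar>\<omega>' v - \<omega> v\<bar> + \<bar>\<omega>' v - \<omega> v\<bar>)" .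
  qed (auto intro: principal_ideal_scale)
  have sup: "P (sup v w)" if "P v" "P w" for v w
    using that
  proof (rule comb[of _ _ 1])
    fix e f \<omega> \<omega>'
    assume nn: "0 \<le> e" "0 \<le> f" and I: "v \<in> principal_ideal (e \<otimes> f)" "w \<in> principal_ideal (e \<otimes> f)"
      and h: "ideal_hom (e \<otimes> f) \<omega>" "ideal_hom (e \<otimes> f) \<omega>'"
    show "\<bar>\<omega>' (sup v w) - \<omega> (sup v w)\<bar> \<le> 1 * (\<bar>\<omega>' v - \<omega> v\<bar> + \<bar>\<omega>' w - \<omega> w\<bar>)"
      unfolding h[THEN ideal_homD(4)[OF _ nonneg[OF nn] I]] mult_1_left by linarith
  qed (auto intro: principal_ideal_sup)
  have inf: "P (inf v w)" if "P v" "P w" for v w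
    using scale[OF sup[OF scale[OF that(1), of "- 1"] scale[OF that(2), of "- 1"]], of "- 1"]
    by simp
  have "vector_sublattice {w. P w}"
    using tensor[of 0 0] add scale sup inf by (simp add: vector_sublattice_def subspace_def)
  then have "vector_sublattice hull {x \<otimes> y | x y. True} \<subseteq> {w. P w}"
    using tensor by (intro hull_minimal) auto
  with gen have "P w" by blast
  then show thesis using that unfolding P_def by blast
qed

end

section \<open>Order density of the elementary tensors\<close>

locale generating_bimorphism = bimorphism tn
  for tn :: "'e::archimedean_vector_lattice \<Rightarrow> 'f::archimedean_vector_lattice
    \<Rightarrow> 't::archimedean_vector_lattice" (infixl "\<otimes>" 70) +
  assumes nondegenerate: "x \<noteq> 0 \<Longrightarrow> y \<noteq> 0 \<Longrightarrow> x \<otimes> y \<noteq> 0"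
    and generating: "vector_sublattice hull {x \<otimes> y | x y. True} = UNIV"
begin

text \<open>At some \<omega> the value of \<open>w\<close> is positive, and on a basic neighbourhood
  given by \<open>x \<otimes> y\<close> it stays above half of it, \<open>c\<close>. There
  \<open>c *\<^sub>R (x \<otimes> y)\<close> is at most \<open>c\<close>, as
  \<open>x \<otimes> y \<le> e \<otimes> f\<close>; elsewhere its value is at most 0. So it lies
  below \<open>w\<close> pointwise.\<close>

lemma tensors_order_dense:
  assumes w: "0 \<le> w" "w \<noteq> 0"
  obtains x y where "0 \<le> x" "x \<noteq> 0" "0 \<le> y" "y \<noteq> 0" "x \<otimes> y \<le> w"
proof -
  obtain e f where e: "0 \<le> e" and f: "0 \<le> f" and cont: "tensor_continuous e f w"
    using tensor_continuous_generated[of w] generating by (metis UNIV_I order_refl)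
  have wI: "w \<in> principal_ideal (e \<otimes> f)" using cont by (simp add: tensor_continuous_def)
  note ef = nonneg[OF e f]
  have "\<not> w \<le> 0" using w by (simp add: order.antisym)
  then obtain \<omega> where \<omega>: "ideal_hom (e \<otimes> f) \<omega>" "0 < \<omega> w"
    using ideal_hom_separates[OF ef wI] by blast
  define c where "c = \<omega> w / 2"
  have c: "0 < c" using \<omega>(2) by (simp add: c_def)
  obtain x y where xy: "x \<in> {0..e}" "y \<in> {0..f}" "0 < \<omega> (x \<otimes> y)"
    "\<And>\<omega>'. ideal_hom (e \<otimes> f) \<omega>' \<Longrightarrow> 0 < \<omega>' (x \<otimes> y) \<Longrightarrow> \<bar>\<omega>' w - \<omega> w\<bar> < c"
    using cont \<omega>(1) c unfolding tensor_continuous_def by metis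
  have I: "x \<otimes> y \<in> principal_ideal (e \<otimes> f)"
    using xy(1,2) by (intro mem_ideal e f) (auto intro: principal_idealI[of _ 1])
  have "c *\<^sub>R (x \<otimes> y) \<le> w"
  proof (rule ideal_hom_leI[OF ef principal_ideal_scale[OF I] wI])
    fix \<omega>' assume \<omega>': "ideal_hom (e \<otimes> f) \<omega>'"
    note D = ideal_homD[OF \<omega>' ef]
    have "x \<otimes> y \<le> e \<otimes> f" using xy by (intro mono) auto
    then have le1: "\<omega>' (x \<otimes> y) \<le> 1" using D(1,7) I principal_ideal_self[OF ef] by metis
    have "0 \<le> \<omega>' w" using D(7)[OF principal_ideal_zero[OF ef] wI w(1)] D(8) by simp
    moreover have "c \<le> \<omega>' w" if "0 < \<omega>' (x \<otimes> y)"
      using xy(4)[OF \<omega>' that] unfolding c_def abs_less_iff by auto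
    moreover have "c * \<omega>' (x \<otimes> y) \<le> c" using le1 c by (simp add: mult_le_cancel_left1)
    moreover have "c * \<omega>' (x \<otimes> y) \<le> 0" if "\<not> 0 < \<omega>' (x \<otimes> y)"
      using that c by (simp add: mult_le_0_iff)
    ultimately have "c * \<omega>' (x \<otimes> y) \<le> \<omega>' w" by (meson order_trans)
    then show "\<omega>' (c *\<^sub>R (x \<otimes> y)) \<le> \<omega>' w" by (simp add: D(5)[OF I])
  qed
  then have "(c *\<^sub>R x) \<otimes> y \<le> w" by (simp add: scale_left)
  moreover have "x \<otimes> y \<noteq> 0" using xy(3) ideal_homD(8)[OF \<omega>(1) ef] by auto
  then have "c *\<^sub>R x \<noteq> 0" "y \<noteq> 0" using c by auto
  moreover have "0 \<le> c *\<^sub>R x" "0 \<le> y" using xy c by (auto intro: scaleR_nonneg_nonneg)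
  ultimately show thesis using that by blast
qed

text \<open>Evaluation at homomorphisms shows that the positive parts of
  \<open>\<eta> *\<^sub>R x - u\<close> and \<open>y - \<eta> *\<^sub>R v\<close> have tensor 0. The
  second part is nonzero by hypothesis, so nondegeneracy makes the first one vanish.\<close>

lemma tensor_le_cancel:
  assumes nn: "0 \<le> x" "0 \<le> u" "0 \<le> y" "0 \<le> v" and le: "x \<otimes> y \<le> u \<otimes> v"
    and \<eta>: "0 < \<eta>" "\<not> y \<le> \<eta> *\<^sub>R v"
  shows "\<eta> *\<^sub>R x \<le> u"
proof -
  \<comment> \<open>The sums are chosen only to dominate the given elements, so that all of them lie
    in the two ideals.\<close>
  define e f where "e = x + u" and "f = y + v"
  have e: "0 \<le> e" and f: "0 \<le> f" using nn by (simp_all add: e_def f_def)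
  have I: "x \<in> principal_ideal e" "u \<in> principal_ideal e" "y \<in> principal_ideal f" "v \<in> principal_ideal f"
    using nn by (auto simp: e_def f_def intro!: principal_idealI[of _ 1])
  let ?p = "sup (\<eta> *\<^sub>R x - u) 0" and ?q = "sup (y - \<eta> *\<^sub>R v) 0"
  have pI: "?p \<in> principal_ideal e" and qI: "?q \<in> principal_ideal f"
    using I e f by (auto intro!: principal_ideal_sup principal_ideal_diff principal_ideal_scale
        principal_ideal_zero)
  have "?p \<otimes> ?q \<le> 0"
  proof (rule ideal_hom_leI[OF nonneg[OF e f] mem_ideal[OF e f pI qI] principal_ideal_zero[OF nonneg[OF e f]]])
    fix \<omega> assume \<omega>: "ideal_hom (e \<otimes> f) \<omega>"
    note P = hom_product[OF e f \<omega>] and D = ideal_homD[OF \<omega> nonneg[OF e f]]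
    note L = ideal_homD[OF hom_left[OF e f \<omega>] e] and R = ideal_homD[OF hom_right[OF e f \<omega>] f]
    define a b c d where "a = \<omega> (x \<otimes> f)" and "b = \<omega> (u \<otimes> f)" and "c = \<omega> (e \<otimes> y)" and "d = \<omega> (e \<otimes> v)"
    have abcd: "0 \<le> a" "0 \<le> b" "0 \<le> c" "0 \<le> d"
      using L(7)[OF principal_ideal_zero[OF e] _ nn(1)] L(7)[OF principal_ideal_zero[OF e] _ nn(2)]
        R(7)[OF principal_ideal_zero[OF f] _ nn(3)] R(7)[OF principal_ideal_zero[OF f] _ nn(4)]
        I L(8) R(8) by (auto simp: a_def b_def c_def d_def)
    have "\<omega> (x \<otimes> y) \<le> \<omega> (u \<otimes> v)" using I e f le by (intro D(7) mem_ideal)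
    then have prod: "a * c \<le> b * d" unfolding P[OF I(1,3)] P[OF I(2,4)] a_def b_def c_def d_def .
    have "\<omega> (?p \<otimes> f) = max (\<eta> * a - b) 0"
      by (simp add: L I principal_ideal_diff principal_ideal_scale principal_ideal_zero[OF e] D(8) a_def b_def)
    moreover have "\<omega> (e \<otimes> ?q) = max (c - \<eta> * d) 0"
      by (simp add: R I principal_ideal_diff principal_ideal_scale principal_ideal_zero[OF f] D(8) c_def d_def)
    moreover have "max (\<eta> * a - b) 0 * max (c - \<eta> * d) 0 = 0"
    proof (rule ccontr)
      assume "\<not> ?thesis"
      then have *: "b < \<eta> * a" "\<eta> * d < c" by (auto simp: max_def split: if_splits)
      \<comment> \<open>If both positive parts had positive value, these inequalities would give
        \<open>b * d < a * c\<close>, contrary to \<open>prod\<close>.\<close>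
      then have "b * (\<eta> * d) \<le> b * c" "b * c < \<eta> * a * c"
        using abcd \<eta>(1) by (auto intro!: mult_left_mono mult_strict_right_mono intro: le_less_trans[of _ "\<eta> * d"])
      then have "\<eta> * (b * d) < \<eta> * (a * c)" by (simp add: ac_simps)
      then show False using prod \<eta>(1) by simp
    qed
    ultimately show "\<omega> (?p \<otimes> ?q) \<le> \<omega> 0" by (simp only: P[OF pI qI] D(8) order_refl)
  qed
  moreover have "0 \<le> ?p \<otimes> ?q" by (intro nonneg) simp_all
  ultimately have "?p \<otimes> ?q = 0" by (rule order.antisym)
  moreover have "?q \<noteq> 0" using \<eta>(2) by (metis diff_le_0_iff_le sup_ge1)
  ultimately have "?p = 0" using nondegenerate by blast
  then show ?thesis by (metis diff_le_0_iff_le sup_ge1)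
qed

section \<open>Order convergence of the tensor net\<close>

theorem decreases_to_zero_tensor:
  assumes u: "decreases_to_zero C leC u" and v: "decreases_to_zero D leD v"
  shows "decreases_to_zero (C \<times> D) (prod_le leC leD) (\<lambda>(c, d). u c \<otimes> v d)"
proof -
  have C: "directed_set C leC" "\<And>c c'. c \<in> C \<Longrightarrow> c' \<in> C \<Longrightarrow> leC c c' \<Longrightarrow> u c' \<le> u c"
    "\<And>c. c \<in> C \<Longrightarrow> 0 \<le> u c" "\<And>w. (\<And>c. c \<in> C \<Longrightarrow> w \<le> u c) \<Longrightarrow> w \<le> 0"
    using u unfolding decreases_to_zero_def by blast+
  have D: "directed_set D leD" "\<And>d d'. d \<in> D \<Longrightarrow> d' \<in> D \<Longrightarrow> leD d d' \<Longrightarrow> v d' \<le> v d"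
    "\<And>d. d \<in> D \<Longrightarrow> 0 \<le> v d"
    using v unfolding decreases_to_zero_def by blast+
  have glb: "w \<le> 0" if w: "\<And>c d. c \<in> C \<Longrightarrow> d \<in> D \<Longrightarrow> w \<le> u c \<otimes> v d" for w
  proof (rule ccontr)
    assume "\<not> w \<le> 0"
    \<comment> \<open>The positive part of \<open>w\<close> is still a lower bound, because all
      tensors of the net are nonnegative.\<close>
    then have "sup w 0 \<noteq> 0" by (metis sup_ge1)
    then obtain x y where xy: "0 \<le> x" "x \<noteq> 0" "0 \<le> y" "y \<noteq> 0" "x \<otimes> y \<le> sup w 0"
      using tensors_order_dense[of "sup w 0"] by auto
    obtain d where d: "d \<in> D" using directed_set_nonempty[OF D(1)] by blast
    have "\<not> y \<le> 0" using xy by (simp add: order.antisym)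
    \<comment> \<open>One index \<open>d\<close> is fixed, so \<eta> does not depend on
      \<open>c\<close> and \<open>\<eta> *\<^sub>R x\<close> is a lower bound of the whole net
      \<open>u\<close>.\<close>
    then obtain \<eta> where \<eta>: "0 < \<eta>" "\<not> y \<le> \<eta> *\<^sub>R v d"
      using archimedean_epsilon[OF D(3)[OF d], of y] by blast
    have "\<eta> *\<^sub>R x \<le> u c" if c: "c \<in> C" for c
    proof (rule tensor_le_cancel[OF xy(1) C(3)[OF c] xy(3) D(3)[OF d] _ \<eta>])
      have "sup w 0 \<le> u c \<otimes> v d" using w[OF c d] nonneg[OF C(3)[OF c] D(3)[OF d]] by simp
      with xy(5) show "x \<otimes> y \<le> u c \<otimes> v d" by (rule order_trans)
    qed
    then have "\<eta> *\<^sub>R x \<le> 0" by (rule C(4))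
    then have "(1 / \<eta>) *\<^sub>R (\<eta> *\<^sub>R x) \<le> (1 / \<eta>) *\<^sub>R 0" using \<eta>(1) by (intro scaleR_left_mono) auto
    then have "x \<le> 0" using \<eta>(1) by simp
    with xy(1,2) show False using order.antisym by blast
  qed
  show ?thesis
    unfolding decreases_to_zero_def
    using directed_set_prod[OF C(1) D(1)] glb C(2,3) D(2,3)
    by (auto simp: prod_le_def intro!: mono nonneg)
qed

theorem order_converges_tensor:
  assumes x: "order_converges A leA x 0" and y: "order_converges B leB y 0"
  shows "order_converges (A \<times> B) (prod_le leA leB) (\<lambda>(\<alpha>, \<beta>). x \<alpha> \<otimes> y \<beta>) 0"
proof -
  obtain C leC u where u: "decreases_to_zero (C :: 'e set) leC u"
    and xu: "\<And>c. c \<in> C \<Longrightarrow> \<exists>a0\<in>A. \<forall>a\<in>A. leA a0 a \<longrightarrow> \<bar>x a\<bar> \<le> u c"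
    using x unfolding order_converges_def by auto
  obtain D leD v where v: "decreases_to_zero (D :: 'f set) leD v"
    and yv: "\<And>d. d \<in> D \<Longrightarrow> \<exists>b0\<in>B. \<forall>b\<in>B. leB b0 b \<longrightarrow> \<bar>y b\<bar> \<le> v d"
    using y unfolding order_converges_def by auto
  show ?thesis
  \<comment> \<open>The dominating net is indexed by \<open>C \<times> D\<close>;
    \<open>order_convergesI\<close> replaces this by an index set inside the tensor lattice.\<close>
  proof (rule order_convergesI[OF decreases_to_zero_tensor[OF u v]])
    fix cd assume "cd \<in> C \<times> D"
    then obtain c d where cd: "cd = (c, d)" "c \<in> C" "d \<in> D" by blast
    obtain a0 where a0: "a0 \<in> A" "\<And>a. a \<in> A \<Longrightarrow> leA a0 a \<Longrightarrow> \<bar>x a\<bar> \<le> u c" using xu[OF cd(2)] by blast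
    obtain b0 where b0: "b0 \<in> B" "\<And>b. b \<in> B \<Longrightarrow> leB b0 b \<Longrightarrow> \<bar>y b\<bar> \<le> v d" using yv[OF cd(3)] by blast
    have "\<bar>x a \<otimes> y b\<bar> \<le> u c \<otimes> v d" if "a \<in> A" "b \<in> B" "leA a0 a" "leB b0 b" for a b
      by (rule order_trans[OF abs_le]) (intro mono a0 b0 that abs_ge_zero)
    then show "\<exists>p0\<in>A \<times> B. \<forall>p\<in>A \<times> B. prod_le leA leB p0 p \<longrightarrow>
        \<bar>(case p of (\<alpha>, \<beta>) \<Rightarrow> x \<alpha> \<otimes> y \<beta>) - 0\<bar> \<le> (case cd of (c, d) \<Rightarrow> u c \<otimes> v d)"
      using a0(1) b0(1) by (intro bexI[of _ "(a0, b0)"]) (auto simp: prod_le_def cd(1))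
  qed
qed

end

text \<open>Nondegeneracy comes from the algebraic tensor product: a pure tensor of nonzero vectors
  is nonzero there, and \<iota> is injective.\<close>

lemma fremlin_tensor_product_generating:
  fixes tn :: "'e::archimedean_vector_lattice \<Rightarrow> 'f::archimedean_vector_lattice
      \<Rightarrow> 't::archimedean_vector_lattice"
  assumes tn: "fremlin_tensor_product tn"
  shows "generating_bimorphism tn"
proof
  show "lattice_bimorphism class_vlat tn" "vector_sublattice hull {tn x y | x y. True} = UNIV"
    using tn by (simp_all add: fremlin_tensor_product_def)
  fix x :: 'e and y :: 'f assume "x \<noteq> 0" "y \<noteq> 0"
  obtain \<iota> :: "('e, 'f) alg_tensor \<Rightarrow> 't"
    where \<iota>: "linear \<iota>" "inj \<iota>" "\<And>x y. \<iota> (pure_tensor x y) = tn x y"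
    using tn unfolding fremlin_tensor_product_def by blast
  show "tn x y \<noteq> 0"
    using pure_tensor_nonzero[OF \<open>x \<noteq> 0\<close> \<open>y \<noteq> 0\<close>] \<iota> linear_injective_0[OF \<iota>(1)] by metis
qed

theorem corollary10:
  fixes tn :: "'e::archimedean_vector_lattice \<Rightarrow> 'f::archimedean_vector_lattice
      \<Rightarrow> 't::archimedean_vector_lattice"
    and A :: "'a set" and leA :: "'a \<Rightarrow> 'a \<Rightarrow> bool" and x :: "'a \<Rightarrow> 'e"
    and B :: "'b set" and leB :: "'b \<Rightarrow> 'b \<Rightarrow> bool" and y :: "'b \<Rightarrow> 'f"
  assumes "fremlin_tensor_product tn"
    and "directed_set A leA" and "order_converges A leA x 0"
    and "directed_set B leB" and "order_converges B leB y 0"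
  shows "order_converges (A \<times> B) (prod_le leA leB) (\<lambda>(\<alpha>, \<beta>). tn (x \<alpha>) (y \<beta>)) 0"
  using fremlin_tensor_product_generating[OF assms(1)] assms(3,5)
  by (rule generating_bimorphism.order_converges_tensor)

end
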